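(* Let $\mathcal{A}$ be a locally noetherian Grothendieck category and $(\mathcal{T},\mathcal{F})$ a torsion theory in $\mathcal{A}$. Then the following are equivalent: (1) $(\mathcal{T},\mathcal{F})$ is prime; (2) $\mathcal{F}$ is $+$-irreducible in the lattice of torsionfree classes; (3) $\mathcal{T}$ is $\cap$-irreducible in the lattice of torsion classes.
   Context: A Grothendieck category is locally noetherian if it has a generating set of noetherian objects. A torsion theory here means a hereditary one: a pair $(\mathcal{T},\mathcal{F})$ of classes of objects with no non-zero maps from objects of $\mathcal{T}$ to objects of $\mathcal{F}$, both maximal with this property, and with the torsion class $\mathcal{T}$ closed under subobjects. Each of $\mathcal{T}$ and the torsionfree class $\mathcal{F}$ determines the other; objects of $\mathcal{T}$ are called $\mathcal{F}$-torsion. Any intersection of torsion classes (resp. torsionfree classes) is again one. The set of torsion classes, and the set of torsionfree classes, ordered by inclusion, are complete lattices, dual to each other: the meet is intersection, and the join, written as a sum $+$, of torsionfree classes $\mathcal{F}_i$ is the torsionfree class corresponding to the intersection of the corresponding torsion classes (similarly with the roles exchanged). $\mathcal{F}(A)$ is the smallest torsionfree class containing the object $A$. A non-zero object $A$ is torsion-critical if every proper quotient of $A$ (by a non-zero subobject) is $\mathcal{F}(A)$-torsion. A torsion theory is prime if its torsionfree class is $\mathcal{F}(A)$ for some torsion-critical $A$. A torsionfree class $\mathcal{F}$ is $+$-irreducible if $\mathcal{F}\neq0$ and $\mathcal{F}=\mathcal{F}_1+\mathcal{F}_2$ with $\mathcal{F}_1,\mathcal{F}_2$ torsionfree classes implies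 $\mathcal{F}=\mathcal{F}_1$ or $\mathcal{F}=\mathcal{F}_2$. A torsion class $\mathcal{T}$ is $\cap$-irreducible if $\mathcal{T}\neq\mathcal{A}$ and $\mathcal{T}=\mathcal{T}_1\cap\mathcal{T}_2$ with $\mathcal{T}_1,\mathcal{T}_2$ torsion classes implies $\mathcal{T}=\mathcal{T}_1$ or $\mathcal{T}=\mathcal{T}_2$. *)

theory Defs
  imports "HOL-Algebra.Group" "HOL-Library.Equipollence"
begin

section \<open>Categories with a partial addition of arrows\<close>

text \<open>Composition is written in the usual order: \<open>g \<diamondop>\<^bsub>C\<^esub> f\<close> is \<open>g\<close> after \<open>f\<close>.
  The operations carry no meaning on arguments that are not objects or arrows of the category
  or that do not fit together.\<close>

record ('o, 'm) ab_cat =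
  obj :: "'o set"
  arr :: "'m set"
  src :: "'m \<Rightarrow> 'o"
  tgt :: "'m \<Rightarrow> 'o"
  ident :: "'o \<Rightarrow> 'm"
  cmp :: "'m \<Rightarrow> 'm \<Rightarrow> 'm"  (infixr \<open>\<diamondop>\<index>\<close> 70)
  zero_arr :: "'o \<Rightarrow> 'o \<Rightarrow> 'm"
  add_arr :: "'m \<Rightarrow> 'm \<Rightarrow> 'm"  (infixl \<open>\<boxplus>\<index>\<close> 65)

definition Hom :: "('o, 'm, 'z) ab_cat_scheme \<Rightarrow> 'o \<Rightarrow> 'o \<Rightarrow> 'm set" where
  "Hom C A B = {f \<in> arr C. src C f = A \<and> tgt C f = B}"

definition hom_group :: "('o, 'm, 'z) ab_cat_scheme \<Rightarrow> 'o \<Rightarrow> 'o \<Rightarrow> 'm monoid" where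
  "hom_group C A B = \<lparr>carrier = Hom C A B, mult = add_arr C, one = zero_arr C A B\<rparr>"

locale category =
  fixes C :: "('o, 'm, 'z) ab_cat_scheme" (structure)
  assumes src_obj: "f \<in> arr C \<Longrightarrow> src C f \<in> obj C"
    and tgt_obj: "f \<in> arr C \<Longrightarrow> tgt C f \<in> obj C"
    and ident_in_Hom: "A \<in> obj C \<Longrightarrow> ident C A \<in> Hom C A A"
    and cmp_in_Hom: "f \<in> Hom C A B \<Longrightarrow> g \<in> Hom C B D \<Longrightarrow> g \<diamondop> f \<in> Hom C A D"
    and cmp_ident_right: "f \<in> Hom C A B \<Longrightarrow> f \<diamondop> ident C A = f"
    and cmp_ident_left: "f \<in> Hom C A B \<Longrightarrow> ident C B \<diamondop> f = f"
    and cmp_assoc: "f \<in> Hom C A B \<Longrightarrow> g \<in> Hom C B D \<Longrightarrow> h \<in> Hom C D E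
      \<Longrightarrow> h \<diamondop> (g \<diamondop> f) = (h \<diamondop> g) \<diamondop> f"

locale preadditive_category = category +
  assumes hom_comm_group: "A \<in> obj C \<Longrightarrow> B \<in> obj C \<Longrightarrow> comm_group (hom_group C A B)"
    and cmp_add_right: "f \<in> Hom C A B \<Longrightarrow> f' \<in> Hom C A B \<Longrightarrow> g \<in> Hom C B D
      \<Longrightarrow> g \<diamondop> (f \<boxplus> f') = (g \<diamondop> f) \<boxplus> (g \<diamondop> f')"
    and cmp_add_left: "f \<in> Hom C A B \<Longrightarrow> g \<in> Hom C B D \<Longrightarrow> g' \<in> Hom C B D
      \<Longrightarrow> (g \<boxplus> g') \<diamondop> f = (g \<diamondop> f) \<boxplus> (g' \<diamondop> f)"


section \<open>Arrows and universal constructions\<close>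

definition is_mono :: "('o, 'm, 'z) ab_cat_scheme \<Rightarrow> 'm \<Rightarrow> bool" where
  "is_mono C f \<longleftrightarrow> f \<in> arr C \<and>
    (\<forall>X \<in> obj C. \<forall>g \<in> Hom C X (src C f). \<forall>h \<in> Hom C X (src C f).
      f \<diamondop>\<^bsub>C\<^esub> g = f \<diamondop>\<^bsub>C\<^esub> h \<longrightarrow> g = h)"

definition is_epi :: "('o, 'm, 'z) ab_cat_scheme \<Rightarrow> 'm \<Rightarrow> bool" where
  "is_epi C f \<longleftrightarrow> f \<in> arr C \<and>
    (\<forall>X \<in> obj C. \<forall>g \<in> Hom C (tgt C f) X. \<forall>h \<in> Hom C (tgt C f) X.
      g \<diamondop>\<^bsub>C\<^esub> f = h \<diamondop>\<^bsub>C\<^esub> f \<longrightarrow> g = h)"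

definition zero_objects :: "('o, 'm, 'z) ab_cat_scheme \<Rightarrow> 'o set" where
  "zero_objects C = {Z \<in> obj C. \<forall>A \<in> obj C.
    (\<exists>!f. f \<in> Hom C Z A) \<and> (\<exists>!f. f \<in> Hom C A Z)}"

definition is_kernel :: "('o, 'm, 'z) ab_cat_scheme \<Rightarrow> 'm \<Rightarrow> 'm \<Rightarrow> bool" where
  "is_kernel C k f \<longleftrightarrow> k \<in> arr C \<and> f \<in> arr C \<and> tgt C k = src C f \<and>
    f \<diamondop>\<^bsub>C\<^esub> k = zero_arr C (src C k) (tgt C f) \<and>
    (\<forall>X \<in> obj C. \<forall>h \<in> Hom C X (src C f). f \<diamondop>\<^bsub>C\<^esub> h = zero_arr C X (tgt C f) \<longrightarrow>
      (\<exists>!u. u \<in> Hom C X (src C k) \<and> k \<diamondop>\<^bsub>C\<^esub> u = h))"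

definition is_cokernel :: "('o, 'm, 'z) ab_cat_scheme \<Rightarrow> 'm \<Rightarrow> 'm \<Rightarrow> bool" where
  "is_cokernel C q f \<longleftrightarrow> q \<in> arr C \<and> f \<in> arr C \<and> src C q = tgt C f \<and>
    q \<diamondop>\<^bsub>C\<^esub> f = zero_arr C (src C f) (tgt C q) \<and>
    (\<forall>X \<in> obj C. \<forall>h \<in> Hom C (tgt C f) X. h \<diamondop>\<^bsub>C\<^esub> f = zero_arr C (src C f) X \<longrightarrow>
      (\<exists>!u. u \<in> Hom C (tgt C q) X \<and> u \<diamondop>\<^bsub>C\<^esub> q = h))"

definition is_biproduct ::
  "('o, 'm, 'z) ab_cat_scheme \<Rightarrow> 'o \<Rightarrow> 'o \<Rightarrow> 'o \<Rightarrow> 'm \<Rightarrow> 'm \<Rightarrow> 'm \<Rightarrow> 'm \<Rightarrow> bool" where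
  "is_biproduct C A B P i j p q \<longleftrightarrow>
    i \<in> Hom C A P \<and> j \<in> Hom C B P \<and> p \<in> Hom C P A \<and> q \<in> Hom C P B \<and>
    p \<diamondop>\<^bsub>C\<^esub> i = ident C A \<and> q \<diamondop>\<^bsub>C\<^esub> j = ident C B \<and>
    (i \<diamondop>\<^bsub>C\<^esub> p) \<boxplus>\<^bsub>C\<^esub> (j \<diamondop>\<^bsub>C\<^esub> q) = ident C P"

definition short_exact :: "('o, 'm, 'z) ab_cat_scheme \<Rightarrow> 'm \<Rightarrow> 'm \<Rightarrow> bool" where
  "short_exact C f g \<longleftrightarrow> is_kernel C f g \<and> is_cokernel C g f"

definition is_coproduct ::
  "('o, 'm, 'z) ab_cat_scheme \<Rightarrow> 'u set \<Rightarrow> ('u \<Rightarrow> 'o) \<Rightarrow> 'o \<Rightarrow> ('u \<Rightarrow> 'm) \<Rightarrow> bool" where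
  "is_coproduct C I A X \<iota> \<longleftrightarrow> X \<in> obj C \<and> (\<forall>i \<in> I. \<iota> i \<in> Hom C (A i) X) \<and>
    (\<forall>Y \<in> obj C. \<forall>g. (\<forall>i \<in> I. g i \<in> Hom C (A i) Y) \<longrightarrow>
      (\<exists>!u. u \<in> Hom C X Y \<and> (\<forall>i \<in> I. u \<diamondop>\<^bsub>C\<^esub> \<iota> i = g i)))"

definition directed_set :: "'u set \<Rightarrow> 'u rel \<Rightarrow> bool" where
  "directed_set I r \<longleftrightarrow> I \<noteq> {} \<and> preorder_on I r \<and>
    (\<forall>i \<in> I. \<forall>j \<in> I. \<exists>k \<in> I. (i, k) \<in> r \<and> (j, k) \<in> r)"

text \<open>In a system \<open>(A, a)\<close> indexed by \<open>(I, r)\<close>, the transition arrow for \<open>(i, j) \<in> r\<close> is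
  \<open>a i j\<close>, from \<open>A i\<close> to \<open>A j\<close>.\<close>

definition direct_system ::
  "('o, 'm, 'z) ab_cat_scheme \<Rightarrow> 'u set \<Rightarrow> 'u rel \<Rightarrow> ('u \<Rightarrow> 'o) \<Rightarrow> ('u \<Rightarrow> 'u \<Rightarrow> 'm) \<Rightarrow> bool" where
  "direct_system C I r A a \<longleftrightarrow> directed_set I r \<and>
    (\<forall>i \<in> I. A i \<in> obj C \<and> a i i = ident C (A i)) \<and>
    (\<forall>i j. (i, j) \<in> r \<longrightarrow> a i j \<in> Hom C (A i) (A j)) \<and>
    (\<forall>i j k. (i, j) \<in> r \<longrightarrow> (j, k) \<in> r \<longrightarrow> a j k \<diamondop>\<^bsub>C\<^esub> a i j = a i k)"

definition system_map ::
  "('o, 'm, 'z) ab_cat_scheme \<Rightarrow> 'u set \<Rightarrow> 'u rel \<Rightarrow> ('u \<Rightarrow> 'o) \<Rightarrow> ('u \<Rightarrow> 'u \<Rightarrow> 'm)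
    \<Rightarrow> ('u \<Rightarrow> 'o) \<Rightarrow> ('u \<Rightarrow> 'u \<Rightarrow> 'm) \<Rightarrow> ('u \<Rightarrow> 'm) \<Rightarrow> bool" where
  "system_map C I r A a B b f \<longleftrightarrow> (\<forall>i \<in> I. f i \<in> Hom C (A i) (B i)) \<and>
    (\<forall>i j. (i, j) \<in> r \<longrightarrow> f j \<diamondop>\<^bsub>C\<^esub> a i j = b i j \<diamondop>\<^bsub>C\<^esub> f i)"

definition is_cocone ::
  "('o, 'm, 'z) ab_cat_scheme \<Rightarrow> 'u set \<Rightarrow> 'u rel \<Rightarrow> ('u \<Rightarrow> 'o) \<Rightarrow> ('u \<Rightarrow> 'u \<Rightarrow> 'm)
    \<Rightarrow> 'o \<Rightarrow> ('u \<Rightarrow> 'm) \<Rightarrow> bool" where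
  "is_cocone C I r A a X c \<longleftrightarrow> X \<in> obj C \<and> (\<forall>i \<in> I. c i \<in> Hom C (A i) X) \<and>
    (\<forall>i j. (i, j) \<in> r \<longrightarrow> c j \<diamondop>\<^bsub>C\<^esub> a i j = c i)"

definition is_colimit ::
  "('o, 'm, 'z) ab_cat_scheme \<Rightarrow> 'u set \<Rightarrow> 'u rel \<Rightarrow> ('u \<Rightarrow> 'o) \<Rightarrow> ('u \<Rightarrow> 'u \<Rightarrow> 'm)
    \<Rightarrow> 'o \<Rightarrow> ('u \<Rightarrow> 'm) \<Rightarrow> bool" where
  "is_colimit C I r A a X c \<longleftrightarrow> is_cocone C I r A a X c \<and>
    (\<forall>Y d. is_cocone C I r A a Y d \<longrightarrow>
      (\<exists>!u. u \<in> Hom C X Y \<and> (\<forall>i \<in> I. u \<diamondop>\<^bsub>C\<^esub> c i = d i)))"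

definition generating :: "('o, 'm, 'z) ab_cat_scheme \<Rightarrow> 'o set \<Rightarrow> bool" where
  "generating C S \<longleftrightarrow> S \<subseteq> obj C \<and>
    (\<forall>A \<in> obj C. \<forall>B \<in> obj C. \<forall>f \<in> Hom C A B. \<forall>g \<in> Hom C A B. f \<noteq> g \<longrightarrow>
      (\<exists>G \<in> S. \<exists>h \<in> Hom C G A. f \<diamondop>\<^bsub>C\<^esub> h \<noteq> g \<diamondop>\<^bsub>C\<^esub> h))"


section \<open>Abelian and Grothendieck categories\<close>

locale abelian_category = preadditive_category +
  assumes ex_zero_object: "zero_objects C \<noteq> {}"
    and ex_biproduct: "A \<in> obj C \<Longrightarrow> B \<in> obj C \<Longrightarrow> \<exists>P i j p q. is_biproduct C A B P i j p q"
    and ex_kernel: "f \<in> arr C \<Longrightarrow> \<exists>k. is_kernel C k f"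
    and ex_cokernel: "f \<in> arr C \<Longrightarrow> \<exists>q. is_cokernel C q f"
    and mono_is_kernel: "is_mono C f \<Longrightarrow> \<exists>g. is_kernel C f g"
    and epi_is_cokernel: "is_epi C f \<Longrightarrow> \<exists>g. is_cokernel C f g"

text \<open>HOL has no type of all sets, so the notion of a small set is a parameter: \<open>U\<close> plays the role
  of the universe, a set is small if it is of smaller cardinality than \<open>U\<close>, and \<open>obj C\<close> and
  \<open>arr C\<close> may be as large as classes. No closure property of \<open>U\<close> has to be postulated. If the
  category has a non-zero object \<open>A\<close>, then a small set \<open>I\<close> has a small power set, since
  the power set embeds into the hom-set from the coproduct of \<open>I\<close> copies of \<open>A\<close> to \<open>A\<close>, and small
  unions of small sets are small by the same argument with iterated coproducts and coproduct
  injections. Thus the cardinality of \<open>U\<close> is strongly inaccessible, except that it may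
  also be countably infinite, in which case ``small'' means ``finite''.\<close>

locale grothendieck_category = abelian_category C
  for C :: "('o, 'm, 'z) ab_cat_scheme" (structure) and U :: "'u set" +
  assumes Hom_small: "\<And>A B. A \<in> obj C \<Longrightarrow> B \<in> obj C \<Longrightarrow> Hom C A B \<prec> U"
    and ex_coproduct: "\<And>I A. I \<subseteq> U \<Longrightarrow> I \<prec> U \<Longrightarrow> (\<And>i. i \<in> I \<Longrightarrow> A i \<in> obj C)
      \<Longrightarrow> \<exists>X \<iota>. is_coproduct C I A X \<iota>"
    and direct_limits_exact: "\<And>I r A a B b D d f g X x Y y Z z u v. I \<subseteq> U \<Longrightarrow> I \<prec> U
      \<Longrightarrow> direct_system C I r A a \<Longrightarrow> direct_system C I r B b \<Longrightarrow> direct_system C I r D d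
      \<Longrightarrow> system_map C I r A a B b f \<Longrightarrow> system_map C I r B b D d g
      \<Longrightarrow> (\<And>i. i \<in> I \<Longrightarrow> short_exact C (f i) (g i))
      \<Longrightarrow> is_colimit C I r A a X x \<Longrightarrow> is_colimit C I r B b Y y \<Longrightarrow> is_colimit C I r D d Z z
      \<Longrightarrow> u \<in> Hom C X Y \<Longrightarrow> (\<And>i. i \<in> I \<Longrightarrow> u \<diamondop> x i = y i \<diamondop> f i)
      \<Longrightarrow> v \<in> Hom C Y Z \<Longrightarrow> (\<And>i. i \<in> I \<Longrightarrow> v \<diamondop> y i = z i \<diamondop> g i)
      \<Longrightarrow> short_exact C u v"
    and ex_generator: "\<exists>G. generating C {G}"

text \<open>Subobjects of \<open>A\<close> are represented by monomorphisms with target \<open>A\<close>, ordered by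
  factorization.\<close>

definition subobject_le :: "('o, 'm, 'z) ab_cat_scheme \<Rightarrow> 'm \<Rightarrow> 'm \<Rightarrow> bool" where
  "subobject_le C m n \<longleftrightarrow> (\<exists>u \<in> Hom C (src C m) (src C n). n \<diamondop>\<^bsub>C\<^esub> u = m)"

definition noetherian_object :: "('o, 'm, 'z) ab_cat_scheme \<Rightarrow> 'o \<Rightarrow> bool" where
  "noetherian_object C A \<longleftrightarrow> A \<in> obj C \<and>
    (\<forall>m :: nat \<Rightarrow> 'm. (\<forall>n. is_mono C (m n) \<and> tgt C (m n) = A) \<longrightarrow>
      (\<forall>n. subobject_le C (m n) (m (Suc n))) \<longrightarrow>
      (\<exists>N. \<forall>n \<ge> N. subobject_le C (m n) (m N)))"

locale locally_noetherian_category = grothendieck_category +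
  assumes ex_noetherian_generators:
    "\<exists>S. S \<prec> U \<and> generating C S \<and> (\<forall>G \<in> S. noetherian_object C G)"


section \<open>Hereditary torsion theories\<close>

definition hom_orthogonal :: "('o, 'm, 'z) ab_cat_scheme \<Rightarrow> 'o set \<Rightarrow> 'o set \<Rightarrow> bool" where
  "hom_orthogonal C T F \<longleftrightarrow> (\<forall>X \<in> T. \<forall>Y \<in> F. \<forall>f \<in> Hom C X Y. f = zero_arr C X Y)"

definition torsion_theory :: "('o, 'm, 'z) ab_cat_scheme \<Rightarrow> 'o set \<Rightarrow> 'o set \<Rightarrow> bool" where
  "torsion_theory C T F \<longleftrightarrow> T \<subseteq> obj C \<and> F \<subseteq> obj C \<and> hom_orthogonal C T F \<and>
    (\<forall>T'. T \<subseteq> T' \<longrightarrow> T' \<subseteq> obj C \<longrightarrow> hom_orthogonal C T' F \<longrightarrow> T' = T) \<and>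
    (\<forall>F'. F \<subseteq> F' \<longrightarrow> F' \<subseteq> obj C \<longrightarrow> hom_orthogonal C T F' \<longrightarrow> F' = F) \<and>
    (\<forall>m. is_mono C m \<longrightarrow> tgt C m \<in> T \<longrightarrow> src C m \<in> T)"

definition torsion_class :: "('o, 'm, 'z) ab_cat_scheme \<Rightarrow> 'o set \<Rightarrow> bool" where
  "torsion_class C T \<longleftrightarrow> (\<exists>F. torsion_theory C T F)"

definition torsionfree_class :: "('o, 'm, 'z) ab_cat_scheme \<Rightarrow> 'o set \<Rightarrow> bool" where
  "torsionfree_class C F \<longleftrightarrow> (\<exists>T. torsion_theory C T F)"

text \<open>The torsion class corresponding to a torsionfree class, and vice versa.\<close>

definition torsion_of :: "('o, 'm, 'z) ab_cat_scheme \<Rightarrow> 'o set \<Rightarrow> 'o set" where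
  "torsion_of C F = {X \<in> obj C. hom_orthogonal C {X} F}"

definition torsionfree_of :: "('o, 'm, 'z) ab_cat_scheme \<Rightarrow> 'o set \<Rightarrow> 'o set" where
  "torsionfree_of C T = {Y \<in> obj C. hom_orthogonal C T {Y}}"

definition torsionfree_sum ::
  "('o, 'm, 'z) ab_cat_scheme \<Rightarrow> 'o set \<Rightarrow> 'o set \<Rightarrow> 'o set" where
  "torsionfree_sum C F\<^sub>1 F\<^sub>2 = torsionfree_of C (torsion_of C F\<^sub>1 \<inter> torsion_of C F\<^sub>2)"

definition torsionfree_gen :: "('o, 'm, 'z) ab_cat_scheme \<Rightarrow> 'o \<Rightarrow> 'o set" where
  "torsionfree_gen C A = \<Inter>{F. torsionfree_class C F \<and> A \<in> F}"

definition torsion_critical :: "('o, 'm, 'z) ab_cat_scheme \<Rightarrow> 'o \<Rightarrow> bool" where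
  "torsion_critical C A \<longleftrightarrow> A \<in> obj C \<and> A \<notin> zero_objects C \<and>
    (\<forall>m q. is_mono C m \<and> tgt C m = A \<and> src C m \<notin> zero_objects C \<and> is_cokernel C q m \<longrightarrow>
      tgt C q \<in> torsion_of C (torsionfree_gen C A))"

definition prime_torsion_theory :: "('o, 'm, 'z) ab_cat_scheme \<Rightarrow> 'o set \<Rightarrow> 'o set \<Rightarrow> bool" where
  "prime_torsion_theory C T F \<longleftrightarrow> torsion_theory C T F \<and>
    (\<exists>A. torsion_critical C A \<and> F = torsionfree_gen C A)"

definition sum_irreducible :: "('o, 'm, 'z) ab_cat_scheme \<Rightarrow> 'o set \<Rightarrow> bool" where
  "sum_irreducible C F \<longleftrightarrow> torsionfree_class C F \<and> F \<noteq> zero_objects C \<and>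
    (\<forall>F\<^sub>1 F\<^sub>2. torsionfree_class C F\<^sub>1 \<longrightarrow> torsionfree_class C F\<^sub>2 \<longrightarrow>
      F = torsionfree_sum C F\<^sub>1 F\<^sub>2 \<longrightarrow> F = F\<^sub>1 \<or> F = F\<^sub>2)"

definition inter_irreducible :: "('o, 'm, 'z) ab_cat_scheme \<Rightarrow> 'o set \<Rightarrow> bool" where
  "inter_irreducible C T \<longleftrightarrow> torsion_class C T \<and> T \<noteq> obj C \<and>
    (\<forall>T\<^sub>1 T\<^sub>2. torsion_class C T\<^sub>1 \<longrightarrow> torsion_class C T\<^sub>2 \<longrightarrow>
      T = T\<^sub>1 \<inter> T\<^sub>2 \<longrightarrow> T = T\<^sub>1 \<or> T = T\<^sub>2)"

end

theory Submission
  imports Defs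
begin

text \<open>Passing between \<open>\<T>\<close> and \<open>\<F>\<close> is a Galois correspondence exchanging \<open>+\<close> with \<open>\<inter>\<close>, so (2) and (3) are
  equivalent in any abelian category.

  Let \<open>\<F> = \<F>(A)\<close> with \<open>A\<close> torsion-critical and \<open>\<T> = \<T>\<^sub>1 \<inter> \<T>\<^sub>2\<close>. If \<open>A\<close> had nonzero subobjects
  \<open>I\<^sub>1 \<in> \<T>\<^sub>1\<close> and \<open>I\<^sub>2 \<in> \<T>\<^sub>2\<close>, their intersection would lie in \<open>\<T>\<close> and embed into \<open>A \<in> \<F>\<close>, hence vanish;
  then \<open>I\<^sub>1\<close> embeds into \<open>A / I\<^sub>2 \<in> \<T>\<close>, which is impossible. So \<open>A\<close> is torsionfree for some \<open>\<T>\<^sub>i\<close>, which gives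
  \<open>\<T>\<^sub>i = \<T>\<close>.

  Conversely let \<open>\<T>\<close> be \<open>\<inter>\<close>-irreducible. A noetherian generator \<open>G \<notin> \<T>\<close> has a subobject \<open>K\<close> maximal with
  \<open>G / K \<notin> \<T>\<close>; then \<open>A = G / K\<close> lies in \<open>\<F>\<close> and all its proper quotients lie in \<open>\<T>\<close>. (In the quotient
  category by \<open>\<T>\<close>, this is a simple object.) If \<open>A\<close> is torsionfree for \<open>\<T>'\<close>, then
  \<open>(\<T> + \<T>') \<inter> (\<T> + \<langle>A\<rangle>) = \<T>\<close>, because a nonzero map from a subobject \<open>B\<close> of \<open>A\<close> to an object of \<open>\<F>\<close> is
  a monomorphism, so that \<open>B\<close> is torsionfree for \<open>\<T> + \<T>'\<close>. As \<open>A \<notin> \<T>\<close>, irreducibility gives \<open>\<T>' \<subseteq> \<T>\<close>, that is,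
  \<open>\<F> \<subseteq> \<F>'\<close>. Hence \<open>\<F> = \<F>(A)\<close>.

  The joins used here are hereditary because every monomorphism \<open>Y \<rightarrow> X\<close> becomes essential in a suitable
  quotient of \<open>X\<close>; this is the only use of exact direct limits, through Zorn's lemma.\<close>

section \<open>Kernels and images in abelian categories\<close>

context category
begin

lemma Hom_obj:
  assumes "f \<in> Hom C A B"
  shows "A \<in> obj C" "B \<in> obj C"
  using assms src_obj tgt_obj by (auto simp: Hom_def)

lemma HomD:
  assumes "f \<in> Hom C A B"
  shows "f \<in> arr C" "src C f = A" "tgt C f = B"
  using assms by (auto simp: Hom_def)

lemma mono_cancel:
  assumes "is_mono C f" "f \<in> Hom C A B" "g \<in> Hom C X A" "h \<in> Hom C X A" "f \<diamondop> g = f \<diamondop> h"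
  shows "g = h"
  using assms Hom_obj[OF assms(3)] unfolding is_mono_def Hom_def by auto

lemma epi_cancel:
  assumes "is_epi C f" "f \<in> Hom C A B" "g \<in> Hom C B X" "h \<in> Hom C B X" "g \<diamondop> f = h \<diamondop> f"
  shows "g = h"
  using assms Hom_obj[OF assms(3)] unfolding is_epi_def Hom_def by auto

lemma monoI:
  assumes "f \<in> Hom C A B"
    and "\<And>X g h. g \<in> Hom C X A \<Longrightarrow> h \<in> Hom C X A \<Longrightarrow> f \<diamondop> g = f \<diamondop> h \<Longrightarrow> g = h"
  shows "is_mono C f"
  using assms unfolding is_mono_def Hom_def by auto

lemma epiI:
  assumes "f \<in> Hom C A B"
    and "\<And>X g h. g \<in> Hom C B X \<Longrightarrow> h \<in> Hom C B X \<Longrightarrow> g \<diamondop> f = h \<diamondop> f \<Longrightarrow> g = h"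
  shows "is_epi C f"
  using assms unfolding is_epi_def Hom_def by auto

lemma mono_cmp:
  assumes f: "is_mono C f" "f \<in> Hom C A B" and g: "is_mono C g" "g \<in> Hom C B D"
  shows "is_mono C (g \<diamondop> f)"
proof (rule monoI[OF cmp_in_Hom[OF f(2) g(2)]])
  fix X a b assume a: "a \<in> Hom C X A" and b: "b \<in> Hom C X A" and "(g \<diamondop> f) \<diamondop> a = (g \<diamondop> f) \<diamondop> b"
  then have "g \<diamondop> (f \<diamondop> a) = g \<diamondop> (f \<diamondop> b)"
    using cmp_assoc[OF a f(2) g(2)] cmp_assoc[OF b f(2) g(2)] by simp
  then have "f \<diamondop> a = f \<diamondop> b"
    using mono_cancel[OF g cmp_in_Hom[OF a f(2)] cmp_in_Hom[OF b f(2)]] by simp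
  then show "a = b" using mono_cancel[OF f a b] by simp
qed

lemma mono_of_cmp:
  assumes "is_mono C (g \<diamondop> f)" "f \<in> Hom C A B" "g \<in> Hom C B D"
  shows "is_mono C f"
proof (rule monoI[OF assms(2)])
  fix X a b assume a: "a \<in> Hom C X A" and b: "b \<in> Hom C X A" and "f \<diamondop> a = f \<diamondop> b"
  then have "(g \<diamondop> f) \<diamondop> a = (g \<diamondop> f) \<diamondop> b"
    using cmp_assoc[OF a assms(2,3)] cmp_assoc[OF b assms(2,3)] by simp
  then show "a = b"
    using mono_cancel[OF assms(1) cmp_in_Hom[OF assms(2,3)] a b] by simp
qed

lemma epi_cmp:
  assumes f: "is_epi C f" "f \<in> Hom C A B" and g: "is_epi C g" "g \<in> Hom C B D"
  shows "is_epi C (g \<diamondop> f)"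
proof (rule epiI[OF cmp_in_Hom[OF f(2) g(2)]])
  fix X a b assume a: "a \<in> Hom C D X" and b: "b \<in> Hom C D X" and "a \<diamondop> (g \<diamondop> f) = b \<diamondop> (g \<diamondop> f)"
  then have "(a \<diamondop> g) \<diamondop> f = (b \<diamondop> g) \<diamondop> f"
    using cmp_assoc[OF f(2) g(2) a] cmp_assoc[OF f(2) g(2) b] by simp
  then have "a \<diamondop> g = b \<diamondop> g"
    using epi_cancel[OF f cmp_in_Hom[OF g(2) a] cmp_in_Hom[OF g(2) b]] by simp
  then show "a = b" using epi_cancel[OF g a b] by simp
qed

lemma ident_mono: "A \<in> obj C \<Longrightarrow> is_mono C (ident C A)"
  by (rule monoI[OF ident_in_Hom]) (auto simp: cmp_ident_left)

lemma ident_epi: "A \<in> obj C \<Longrightarrow> is_epi C (ident C A)"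
  by (rule epiI[OF ident_in_Hom]) (auto simp: cmp_ident_right)

lemma section_mono:
  assumes "f \<in> Hom C A B" "g \<in> Hom C B A" "g \<diamondop> f = ident C A"
  shows "is_mono C f"
proof (rule mono_of_cmp[OF _ assms(1,2)])
  show "is_mono C (g \<diamondop> f)"
    using assms(3) ident_mono Hom_obj[OF assms(1)] by simp
qed

end

section \<open>Zero arrows, kernels and cokernels\<close>

context preadditive_category
begin

lemma zero_in_Hom: "A \<in> obj C \<Longrightarrow> B \<in> obj C \<Longrightarrow> zero_arr C A B \<in> Hom C A B"
  using monoid.one_closed[OF group.is_monoid[OF comm_group.axioms(2)[OF hom_comm_group]]]
  by (auto simp: hom_group_def)

lemma add_left_neutral:
  assumes "f \<in> Hom C A B"
  shows "zero_arr C A B \<boxplus> f = f"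
proof -
  interpret comm_group "hom_group C A B" using Hom_obj[OF assms] by (rule hom_comm_group)
  show ?thesis using l_one[of f] assms by (simp add: hom_group_def)
qed

lemma add_right_cancel_zero:
  assumes "f \<in> Hom C A B" "f \<boxplus> f = f"
  shows "f = zero_arr C A B"
proof -
  interpret comm_group "hom_group C A B" using Hom_obj[OF assms(1)] by (rule hom_comm_group)
  show ?thesis using l_cancel_one[of f f] assms by (simp add: hom_group_def)
qed

lemma cmp_zero_right:
  assumes g: "g \<in> Hom C B D" and A: "A \<in> obj C"
  shows "g \<diamondop> zero_arr C A B = zero_arr C A D"
proof -
  have z: "zero_arr C A B \<in> Hom C A B" using zero_in_Hom A Hom_obj[OF g] by simp
  have "g \<diamondop> zero_arr C A B \<boxplus> g \<diamondop> zero_arr C A B = g \<diamondop> zero_arr C A B"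
    using cmp_add_right[OF z z g] add_left_neutral[OF z] by simp
  then show ?thesis using add_right_cancel_zero[OF cmp_in_Hom[OF z g]] by simp
qed

lemma cmp_zero_left:
  assumes f: "f \<in> Hom C A B" and D: "D \<in> obj C"
  shows "zero_arr C B D \<diamondop> f = zero_arr C A D"
proof -
  have z: "zero_arr C B D \<in> Hom C B D" using zero_in_Hom D Hom_obj[OF f] by simp
  have "zero_arr C B D \<diamondop> f \<boxplus> zero_arr C B D \<diamondop> f = zero_arr C B D \<diamondop> f"
    using cmp_add_left[OF f z z] add_left_neutral[OF z] by simp
  then show ?thesis using add_right_cancel_zero[OF cmp_in_Hom[OF f z]] by simp
qed

lemma add_eq_left_iff:
  assumes "g \<in> Hom C A B" "d \<in> Hom C A B"
  shows "d \<boxplus> g = g \<longleftrightarrow> d = zero_arr C A B"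
proof -
  interpret comm_group "hom_group C A B" using Hom_obj[OF assms(1)] by (rule hom_comm_group)
  show ?thesis using r_cancel_one[of g d] assms by (simp add: hom_group_def)
qed

text \<open>Stands in for the difference \<open>f - g\<close>: equality of two composites becomes
  the vanishing of one. From here on no proof has to open the hom group again.\<close>

lemma ex_difference:
  assumes f: "f \<in> Hom C A B" and g: "g \<in> Hom C A B"
  obtains d where "d \<in> Hom C A B" "f = g \<longleftrightarrow> d = zero_arr C A B"
    "\<And>Y u. u \<in> Hom C B Y \<Longrightarrow> u \<diamondop> f = u \<diamondop> g \<longleftrightarrow> u \<diamondop> d = zero_arr C A Y"
    "\<And>X w. w \<in> Hom C X A \<Longrightarrow> f \<diamondop> w = g \<diamondop> w \<longleftrightarrow> d \<diamondop> w = zero_arr C X B"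
proof -
  interpret comm_group "hom_group C A B" using Hom_obj[OF f] by (rule hom_comm_group)
  define d where "d = f \<boxplus> inv\<^bsub>hom_group C A B\<^esub> g"
  have c: "inv\<^bsub>hom_group C A B\<^esub> g \<in> Hom C A B"
    using inv_closed[of g] g by (simp add: hom_group_def)
  have d: "d \<in> Hom C A B"
    using m_closed[of f "inv\<^bsub>hom_group C A B\<^esub> g"] f c unfolding d_def by (simp add: hom_group_def)
  have fd: "f = d \<boxplus> g"
    using inv_solve_right[of d f g] f g d unfolding d_def by (simp add: hom_group_def)
  show thesis
  proof (rule that[OF d])
    show "f = g \<longleftrightarrow> d = zero_arr C A B"
      using add_eq_left_iff[OF g d] fd by simp
    show "u \<diamondop> f = u \<diamondop> g \<longleftrightarrow> u \<diamondop> d = zero_arr C A Y" if u: "u \<in> Hom C B Y" for Y u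
      using add_eq_left_iff[OF cmp_in_Hom[OF g u] cmp_in_Hom[OF d u]] cmp_add_right[OF d g u] fd
      by simp
    show "f \<diamondop> w = g \<diamondop> w \<longleftrightarrow> d \<diamondop> w = zero_arr C X B" if w: "w \<in> Hom C X A" for X w
      using add_eq_left_iff[OF cmp_in_Hom[OF w g] cmp_in_Hom[OF w d]] cmp_add_left[OF w d g] fd
      by simp
  qed
qed

lemma mono_zero_cancel:
  assumes "is_mono C f" "f \<in> Hom C A B" "g \<in> Hom C X A" "f \<diamondop> g = zero_arr C X B"
  shows "g = zero_arr C X A"
  using mono_cancel[OF assms(1-3) zero_in_Hom] cmp_zero_right[OF assms(2)] assms(4)
    Hom_obj[OF assms(3)] by simp

lemma epi_zero_cancel:
  assumes "is_epi C f" "f \<in> Hom C A B" "g \<in> Hom C B X" "g \<diamondop> f = zero_arr C A X"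
  shows "g = zero_arr C B X"
  using epi_cancel[OF assms(1-3) zero_in_Hom] cmp_zero_left[OF assms(2)] assms(4)
    Hom_obj[OF assms(3)] by simp

lemma mono_zeroI:
  assumes f: "f \<in> Hom C A B"
    and z: "\<And>X g. g \<in> Hom C X A \<Longrightarrow> f \<diamondop> g = zero_arr C X B \<Longrightarrow> g = zero_arr C X A"
  shows "is_mono C f"
proof (rule monoI[OF f])
  fix X g h assume g: "g \<in> Hom C X A" and h: "h \<in> Hom C X A" and eq: "f \<diamondop> g = f \<diamondop> h"
  obtain d where d: "d \<in> Hom C X A" "g = h \<longleftrightarrow> d = zero_arr C X A"
    "f \<diamondop> g = f \<diamondop> h \<longleftrightarrow> f \<diamondop> d = zero_arr C X B"
    using ex_difference[OF g h] f by metis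
  show "g = h" using z[OF d(1)] d eq by simp
qed

lemma zero_object_iff:
  "A \<in> zero_objects C \<longleftrightarrow> A \<in> obj C \<and> ident C A = zero_arr C A A"
proof
  assume A: "A \<in> zero_objects C"
  then have "A \<in> obj C" and "\<exists>!f. f \<in> Hom C A A" by (auto simp: zero_objects_def)
  then show "A \<in> obj C \<and> ident C A = zero_arr C A A" using ident_in_Hom zero_in_Hom by blast
next
  assume A: "A \<in> obj C \<and> ident C A = zero_arr C A A"
  have "f = zero_arr C A B" if "f \<in> Hom C A B" for f B
    using cmp_ident_right[OF that] cmp_zero_right[OF that] A by simp
  moreover have "f = zero_arr C B A" if "f \<in> Hom C B A" for f B
    using cmp_ident_left[OF that] cmp_zero_left[OF that] A by simp
  ultimately show "A \<in> zero_objects C"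
    using A zero_in_Hom unfolding zero_objects_def by blast
qed

lemma mono_zero_source:
  assumes "is_mono C m" "m \<in> Hom C A B"
  shows "m = zero_arr C A B \<longleftrightarrow> A \<in> zero_objects C"
proof
  assume "m = zero_arr C A B"
  then show "A \<in> zero_objects C"
    using mono_zero_cancel[OF assms ident_in_Hom] cmp_ident_right[OF assms(2)] Hom_obj[OF assms(2)]
    by (simp add: zero_object_iff)
next
  assume "A \<in> zero_objects C"
  then show "m = zero_arr C A B"
    using cmp_ident_right[OF assms(2)] cmp_zero_right[OF assms(2)] by (simp add: zero_object_iff)
qed

lemma kernelD:
  assumes "is_kernel C k f" "f \<in> Hom C A B"
  shows "k \<in> Hom C (src C k) A" "f \<diamondop> k = zero_arr C (src C k) B" "is_mono C k"
proof -
  show k: "k \<in> Hom C (src C k) A" using assms by (auto simp: is_kernel_def Hom_def)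
  show z: "f \<diamondop> k = zero_arr C (src C k) B" using assms by (auto simp: is_kernel_def Hom_def)
  show "is_mono C k"
  proof (rule monoI[OF k])
    fix X g h assume g: "g \<in> Hom C X (src C k)" and h: "h \<in> Hom C X (src C k)"
      and eq: "k \<diamondop> g = k \<diamondop> h"
    have "f \<diamondop> (k \<diamondop> g) = zero_arr C X B"
      using cmp_assoc[OF g k assms(2)] z cmp_zero_left[OF g] Hom_obj[OF assms(2)] by simp
    then have "\<exists>!u. u \<in> Hom C X (src C k) \<and> k \<diamondop> u = k \<diamondop> g"
      using assms cmp_in_Hom[OF g k] Hom_obj[OF g] HomD[OF assms(2)] unfolding is_kernel_def by auto
    then show "g = h" using g h eq by metis
  qed
qed

lemma kernel_lift:
  assumes "is_kernel C k f" "f \<in> Hom C A B" "h \<in> Hom C X A" "f \<diamondop> h = zero_arr C X B"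
  obtains u where "u \<in> Hom C X (src C k)" "k \<diamondop> u = h"
proof -
  have "\<exists>!u. u \<in> Hom C X (src C k) \<and> k \<diamondop> u = h"
    using assms Hom_obj[OF assms(3)] HomD[OF assms(2)] unfolding is_kernel_def by auto
  then show thesis using that by blast
qed

lemma kernelI:
  assumes k: "k \<in> Hom C K A" "is_mono C k" and f: "f \<in> Hom C A B"
    and z: "f \<diamondop> k = zero_arr C K B"
    and l: "\<And>X h. h \<in> Hom C X A \<Longrightarrow> f \<diamondop> h = zero_arr C X B \<Longrightarrow> \<exists>u\<in>Hom C X K. k \<diamondop> u = h"
  shows "is_kernel C k f"
proof -
  have "\<exists>!u. u \<in> Hom C X K \<and> k \<diamondop> u = h" if h: "h \<in> Hom C X A" "f \<diamondop> h = zero_arr C X B" for X h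
    using l[OF h] mono_cancel[OF k(2,1)] by metis
  then show ?thesis using z HomD[OF k(1)] HomD[OF f] unfolding is_kernel_def by auto
qed

lemma cokernelD:
  assumes "is_cokernel C q f" "f \<in> Hom C A B"
  shows "q \<in> Hom C B (tgt C q)" "q \<diamondop> f = zero_arr C A (tgt C q)" "is_epi C q"
proof -
  show q: "q \<in> Hom C B (tgt C q)" using assms by (auto simp: is_cokernel_def Hom_def)
  show z: "q \<diamondop> f = zero_arr C A (tgt C q)" using assms by (auto simp: is_cokernel_def Hom_def)
  show "is_epi C q"
  proof (rule epiI[OF q])
    fix X g h assume g: "g \<in> Hom C (tgt C q) X" and h: "h \<in> Hom C (tgt C q) X"
      and eq: "g \<diamondop> q = h \<diamondop> q"
    have "(g \<diamondop> q) \<diamondop> f = zero_arr C A X"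
      using cmp_assoc[OF assms(2) q g] z cmp_zero_right[OF g] Hom_obj[OF assms(2)] by simp
    then have "\<exists>!u. u \<in> Hom C (tgt C q) X \<and> u \<diamondop> q = g \<diamondop> q"
      using assms cmp_in_Hom[OF q g] Hom_obj[OF g] HomD[OF assms(2)] unfolding is_cokernel_def by auto
    then show "g = h" using g h eq by metis
  qed
qed

lemma cokernel_lift:
  assumes "is_cokernel C q f" "f \<in> Hom C A B" "h \<in> Hom C B X" "h \<diamondop> f = zero_arr C A X"
  obtains u where "u \<in> Hom C (tgt C q) X" "u \<diamondop> q = h"
proof -
  have "\<exists>!u. u \<in> Hom C (tgt C q) X \<and> u \<diamondop> q = h"
    using assms Hom_obj[OF assms(3)] HomD[OF assms(2)] unfolding is_cokernel_def by auto
  then show thesis using that by blast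
qed

lemma cokernelI:
  assumes q: "q \<in> Hom C B Q" "is_epi C q" and f: "f \<in> Hom C A B"
    and z: "q \<diamondop> f = zero_arr C A Q"
    and l: "\<And>X h. h \<in> Hom C B X \<Longrightarrow> h \<diamondop> f = zero_arr C A X \<Longrightarrow> \<exists>u\<in>Hom C Q X. u \<diamondop> q = h"
  shows "is_cokernel C q f"
proof -
  have "\<exists>!u. u \<in> Hom C Q X \<and> u \<diamondop> q = h" if h: "h \<in> Hom C B X" "h \<diamondop> f = zero_arr C A X" for X h
    using l[OF h] epi_cancel[OF q(2,1)] by metis
  then show ?thesis using z HomD[OF q(1)] HomD[OF f] unfolding is_cokernel_def by auto
qed

end

section \<open>Coimages and image factorization\<close>

context abelian_category
begin

text \<open>By the abelian axiom \<open>e\<close> is a cokernel of some \<open>g\<close>. As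
  \<open>e\<close> kills \<open>g\<close>, \<open>g\<close> factors through \<open>k\<close>; hence
  an arrow that kills \<open>k\<close> also kills \<open>g\<close> and descends along
  \<open>e\<close>.\<close>

lemma epi_cokernel_of_kernel:
  assumes e: "is_epi C e" "e \<in> Hom C A B" and k: "is_kernel C k e"
  shows "is_cokernel C e k"
proof (rule cokernelI[OF e(2,1)])
  note kD = kernelD[OF k e(2)]
  show "k \<in> Hom C (src C k) A" "e \<diamondop> k = zero_arr C (src C k) B" by (fact kD)+
  fix X h assume h: "h \<in> Hom C A X" and z: "h \<diamondop> k = zero_arr C (src C k) X"
  obtain g where g: "is_cokernel C e g" using epi_is_cokernel[OF e(1)] by blast
  have gH: "g \<in> Hom C (src C g) A" using g HomD[OF e(2)] by (auto simp: is_cokernel_def Hom_def)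
  obtain t where t: "t \<in> Hom C (src C g) (src C k)" "k \<diamondop> t = g"
    using kernel_lift[OF k e(2) gH] cokernelD[OF g gH] HomD[OF e(2)] by auto
  have "h \<diamondop> g = zero_arr C (src C g) X"
    using cmp_assoc[OF t(1) kD(1) h] t(2) z cmp_zero_left[OF t(1)] Hom_obj[OF h] by simp
  then show "\<exists>u\<in>Hom C B X. u \<diamondop> e = h"
    using cokernel_lift[OF g gH h] HomD[OF e(2)] by metis
qed

text \<open>The dual argument: \<open>m\<close> is a kernel of some \<open>g\<close>, which factors
  through \<open>q\<close>, so an arrow killed by \<open>q\<close> is killed by \<open>g\<close> and
  lifts along \<open>m\<close>.\<close>

lemma mono_kernel_of_cokernel:
  assumes m: "is_mono C m" "m \<in> Hom C A B" and q: "is_cokernel C q m"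
  shows "is_kernel C m q"
proof (rule kernelI[OF m(2,1)])
  note qD = cokernelD[OF q m(2)]
  show "q \<in> Hom C B (tgt C q)" "q \<diamondop> m = zero_arr C A (tgt C q)" by (fact qD)+
  fix X h assume h: "h \<in> Hom C X B" and z: "q \<diamondop> h = zero_arr C X (tgt C q)"
  obtain g where g: "is_kernel C m g" using mono_is_kernel[OF m(1)] by blast
  have gH: "g \<in> Hom C B (tgt C g)" using g HomD[OF m(2)] by (auto simp: is_kernel_def Hom_def)
  obtain t where t: "t \<in> Hom C (tgt C q) (tgt C g)" "t \<diamondop> q = g"
    using cokernel_lift[OF q m(2) gH] kernelD[OF g gH] HomD[OF m(2)] by auto
  have "g \<diamondop> h = zero_arr C X (tgt C g)"
    using cmp_assoc[OF h qD(1) t(1)] t(2) z cmp_zero_right[OF t(1)] Hom_obj[OF h] by simp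
  then show "\<exists>u\<in>Hom C X A. m \<diamondop> u = h"
    using kernel_lift[OF g gH h] HomD[OF m(2)] by metis
qed

lemma ex_kernel':
  assumes "f \<in> Hom C A B"
  obtains k where "is_kernel C k f"
  using ex_kernel HomD[OF assms] by blast

lemma ex_cokernel':
  assumes "f \<in> Hom C A B"
  obtains q where "is_cokernel C q f"
  using ex_cokernel HomD[OF assms] by blast

text \<open>If \<open>m\<close> kills \<open>x\<close>, it descends to the cokernel \<open>q\<close>
  of \<open>x\<close>. The kernel of \<open>q \<diamondop> e\<close> is then killed by
  \<open>f\<close>, so it factors through \<open>k\<close> and is killed by \<open>e\<close>. Hence
  \<open>e\<close> factors through the epimorphism \<open>q \<diamondop> e\<close>, which makes
  \<open>q\<close> a split monomorphism and \<open>x\<close> zero.\<close>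

lemma coimage_mono:
  assumes k: "is_kernel C k f" and e: "is_cokernel C e k" and f: "f \<in> Hom C A B"
    and m: "m \<in> Hom C (tgt C e) B" and fac: "m \<diamondop> e = f"
  shows "is_mono C m"
proof (rule mono_zeroI[OF m])
  note kD = kernelD[OF k f]
  note eD = cokernelD[OF e kD(1)]
  fix X x assume x: "x \<in> Hom C X (tgt C e)" and z: "m \<diamondop> x = zero_arr C X B"
  obtain q where q: "is_cokernel C q x" by (rule ex_cokernel'[OF x])
  note qD = cokernelD[OF q x]
  obtain m' where m': "m' \<in> Hom C (tgt C q) B" "m' \<diamondop> q = m"
    by (rule cokernel_lift[OF q x m z])
  have qe: "q \<diamondop> e \<in> Hom C A (tgt C q)" "is_epi C (q \<diamondop> e)"
    using cmp_in_Hom[OF eD(1) qD(1)] epi_cmp[OF eD(3,1) qD(3,1)] by auto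
  obtain h where h: "is_kernel C h (q \<diamondop> e)" by (rule ex_kernel'[OF qe(1)])
  note hD = kernelD[OF h qe(1)]
  have mqe: "m' \<diamondop> (q \<diamondop> e) = f"
    using cmp_assoc[OF eD(1) qD(1) m'(1)] m'(2) fac by simp
  have "f \<diamondop> h = zero_arr C (src C h) B"
    using cmp_assoc[OF hD(1) qe(1) m'(1)] hD(2) cmp_zero_right[OF m'(1)] Hom_obj[OF hD(1)] mqe by simp
  then obtain h' where h': "h' \<in> Hom C (src C h) (src C k)" "k \<diamondop> h' = h"
    by (rule kernel_lift[OF k f hD(1)])
  have "e \<diamondop> h = zero_arr C (src C h) (tgt C e)"
    using cmp_assoc[OF h'(1) kD(1) eD(1)] h'(2) eD(2) cmp_zero_left[OF h'(1)] Hom_obj[OF eD(1)] by simp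
  then obtain t where t: "t \<in> Hom C (tgt C q) (tgt C e)" "t \<diamondop> (q \<diamondop> e) = e"
    using cokernel_lift[OF epi_cokernel_of_kernel[OF qe(2,1) h] hD(1) eD(1)] HomD[OF qe(1)] by metis
  have "(t \<diamondop> q) \<diamondop> e = ident C (tgt C e) \<diamondop> e"
    using cmp_assoc[OF eD(1) qD(1) t(1)] t(2) cmp_ident_left[OF eD(1)] by simp
  then have "t \<diamondop> q = ident C (tgt C e)"
    using epi_cancel[OF eD(3,1) cmp_in_Hom[OF qD(1) t(1)] ident_in_Hom] Hom_obj[OF eD(1)] by simp
  then have "is_mono C q" by (rule section_mono[OF qD(1) t(1)])
  then show "x = zero_arr C X (tgt C e)"
    using mono_zero_cancel[OF _ qD(1) x qD(2)] by simp
qed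

text \<open>Kernel and coimage are arguments, so that two arrows with the same kernel factor through
  the same \<open>e\<close>. In this way one coimage is later embedded into two different
  objects.\<close>

lemma coimage_factorization:
  assumes f: "f \<in> Hom C A B" and k: "is_kernel C k f" and e: "is_cokernel C e k"
  obtains m where "m \<in> Hom C (tgt C e) B" "is_mono C m" "m \<diamondop> e = f"
proof -
  note kD = kernelD[OF k f]
  obtain m where m: "m \<in> Hom C (tgt C e) B" "m \<diamondop> e = f"
    by (rule cokernel_lift[OF e kD(1) f kD(2)])
  with coimage_mono[OF k e f m] that show thesis by blast
qed

lemma image_factorization:
  assumes f: "f \<in> Hom C A B"
  obtains I e m where "e \<in> Hom C A I" "is_epi C e" "m \<in> Hom C I B" "is_mono C m" "m \<diamondop> e = f"
proof -
  obtain k where k: "is_kernel C k f" by (rule ex_kernel'[OF f])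
  note kD = kernelD[OF k f]
  obtain e where e: "is_cokernel C e k" by (rule ex_cokernel'[OF kD(1)])
  show thesis
    using coimage_factorization[OF f k e] cokernelD[OF e kD(1)] that by metis
qed

text \<open>Spares a proof that epimorphisms are stable under pullback: the kernel of \<open>r\<close> would be the image
  under \<open>p\<close> of the kernel of \<open>r \<diamondop> p\<close>.\<close>

lemma mono_of_kernel_le:
  assumes p: "is_cokernel C p k" and k: "k \<in> Hom C K A" and r: "r \<in> Hom C (tgt C p) B"
    and n: "is_kernel C n (r \<diamondop> p)" and pn: "p \<diamondop> n = zero_arr C (src C n) (tgt C p)"
  shows "is_mono C r"
proof -
  note pD = cokernelD[OF p k]
  have rp: "r \<diamondop> p \<in> Hom C A B" using cmp_in_Hom[OF pD(1) r] .
  note nD = kernelD[OF n rp]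
  \<comment> \<open>\<open>r \<diamondop> p\<close> kills \<open>k\<close>, so \<open>k\<close>
    factors through \<open>n\<close>, and \<open>p\<close> kills \<open>n\<close>. Thus
    \<open>p\<close> is the coimage of \<open>r \<diamondop> p\<close>, and \<open>r\<close> is the
    arrow induced on it.\<close>
  have "is_cokernel C p n"
  proof (rule cokernelI[OF pD(1,3) nD(1) pn])
    fix X h assume h: "h \<in> Hom C A X" and z: "h \<diamondop> n = zero_arr C (src C n) X"
    have "(r \<diamondop> p) \<diamondop> k = zero_arr C K B"
      using cmp_assoc[OF k pD(1) r] pD(2) cmp_zero_right[OF r] Hom_obj[OF k] by simp
    then obtain t where t: "t \<in> Hom C K (src C n)" "n \<diamondop> t = k" by (rule kernel_lift[OF n rp k])
    have "h \<diamondop> k = zero_arr C K X"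
      using cmp_assoc[OF t(1) nD(1) h] t(2) z cmp_zero_left[OF t(1)] Hom_obj[OF h] by simp
    then show "\<exists>u\<in>Hom C (tgt C p) X. u \<diamondop> p = h" using cokernel_lift[OF p k h] by metis
  qed
  then show ?thesis using coimage_mono[OF n _ rp r] by simp
qed

end

section \<open>Torsion theories in abelian categories\<close>

lemma hom_orthogonalI:
  assumes "\<And>X Y f. X \<in> T \<Longrightarrow> Y \<in> F \<Longrightarrow> f \<in> Hom C X Y \<Longrightarrow> f = zero_arr C X Y"
  shows "hom_orthogonal C T F"
  unfolding hom_orthogonal_def by (intro ballI) (rule assms)

lemma hom_orthogonalD:
  assumes "hom_orthogonal C T F" "X \<in> T" "Y \<in> F" "f \<in> Hom C X Y"
  shows "f = zero_arr C X Y"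
proof -
  have "\<forall>Y\<in>F. \<forall>f\<in>Hom C X Y. f = zero_arr C X Y"
    using assms(1,2) unfolding hom_orthogonal_def by (rule bspec)
  then have "\<forall>f\<in>Hom C X Y. f = zero_arr C X Y" using assms(3) by (rule bspec)
  then show ?thesis using assms(4) by (rule bspec)
qed

lemma torsion_ofI:
  assumes "X \<in> obj C" "\<And>Y f. Y \<in> F \<Longrightarrow> f \<in> Hom C X Y \<Longrightarrow> f = zero_arr C X Y"
  shows "X \<in> torsion_of C F"
proof -
  have "hom_orthogonal C {X} F" using assms(2) by (intro hom_orthogonalI) (simp only: singleton_iff)
  then show ?thesis using assms(1) by (simp add: torsion_of_def)
qed

lemma torsion_ofD:
  assumes "X \<in> torsion_of C F" "Y \<in> F" "f \<in> Hom C X Y"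
  shows "f = zero_arr C X Y"
proof -
  have "hom_orthogonal C {X} F" using assms(1) by (simp add: torsion_of_def)
  then show ?thesis using singletonI assms(2,3) by (rule hom_orthogonalD)
qed

lemma torsionfree_ofI:
  assumes "Y \<in> obj C" "\<And>X f. X \<in> T \<Longrightarrow> f \<in> Hom C X Y \<Longrightarrow> f = zero_arr C X Y"
  shows "Y \<in> torsionfree_of C T"
proof -
  have "hom_orthogonal C T {Y}" using assms(2) by (intro hom_orthogonalI) (simp only: singleton_iff)
  then show ?thesis using assms(1) by (simp add: torsionfree_of_def)
qed

lemma torsionfree_ofD:
  assumes "Y \<in> torsionfree_of C T" "X \<in> T" "f \<in> Hom C X Y"
  shows "f = zero_arr C X Y"
proof -
  have "hom_orthogonal C T {Y}" using assms(1) by (simp add: torsionfree_of_def)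
  then show ?thesis using assms(2) singletonI assms(3) by (rule hom_orthogonalD)
qed

lemma torsion_of_obj: "torsion_of C F \<subseteq> obj C"
  by (auto simp: torsion_of_def)

lemma torsionfree_of_obj: "torsionfree_of C T \<subseteq> obj C"
  by (auto simp: torsionfree_of_def)

text \<open>With its counterpart below, this makes \<open>torsion_of\<close> and
  \<open>torsionfree_of\<close> an antitone Galois connection on classes of objects; the closure
  identities are formal consequences.\<close>

lemma subset_torsion_of_iff:
  assumes "T \<subseteq> obj C"
  shows "T \<subseteq> torsion_of C F \<longleftrightarrow> hom_orthogonal C T F"
proof
  assume T: "T \<subseteq> torsion_of C F"
  show "hom_orthogonal C T F" by (rule hom_orthogonalI) (rule torsion_ofD[OF subsetD[OF T]])
next
  assume h: "hom_orthogonal C T F"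
  show "T \<subseteq> torsion_of C F"
    by (rule subsetI, rule torsion_ofI) (erule subsetD[OF assms], rule hom_orthogonalD[OF h])
qed

lemma subset_torsionfree_of_iff:
  assumes "F \<subseteq> obj C"
  shows "F \<subseteq> torsionfree_of C T \<longleftrightarrow> hom_orthogonal C T F"
proof
  assume F: "F \<subseteq> torsionfree_of C T"
  show "hom_orthogonal C T F" by (rule hom_orthogonalI) (rule torsionfree_ofD[OF subsetD[OF F]])
next
  assume h: "hom_orthogonal C T F"
  show "F \<subseteq> torsionfree_of C T"
    by (rule subsetI, rule torsionfree_ofI) (erule subsetD[OF assms], rule hom_orthogonalD[OF h])
qed

lemma subset_torsion_of_torsionfree_of:
  "T \<subseteq> obj C \<Longrightarrow> T \<subseteq> torsion_of C (torsionfree_of C T)"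
  by (simp add: subset_torsion_of_iff subset_torsionfree_of_iff[symmetric] torsionfree_of_obj)

lemma subset_torsionfree_of_torsion_of:
  "F \<subseteq> obj C \<Longrightarrow> F \<subseteq> torsionfree_of C (torsion_of C F)"
  by (simp add: subset_torsionfree_of_iff subset_torsion_of_iff[symmetric] torsion_of_obj)

lemma torsion_of_antimono:
  assumes "F \<subseteq> F'"
  shows "torsion_of C F' \<subseteq> torsion_of C F"
proof
  fix X assume X: "X \<in> torsion_of C F'"
  show "X \<in> torsion_of C F"
    by (rule torsion_ofI[OF subsetD[OF torsion_of_obj X]]) (rule torsion_ofD[OF X subsetD[OF assms]])
qed

lemma torsionfree_of_antimono:
  assumes "T \<subseteq> T'"
  shows "torsionfree_of C T' \<subseteq> torsionfree_of C T"
proof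
  fix Y assume Y: "Y \<in> torsionfree_of C T'"
  show "Y \<in> torsionfree_of C T"
    by (rule torsionfree_ofI[OF subsetD[OF torsionfree_of_obj Y]])
      (rule torsionfree_ofD[OF Y subsetD[OF assms]])
qed

lemma torsion_of_closed:
  assumes "F \<subseteq> obj C"
  shows "torsion_of C (torsionfree_of C (torsion_of C F)) = torsion_of C F"
proof (rule equalityI)
  show "torsion_of C (torsionfree_of C (torsion_of C F)) \<subseteq> torsion_of C F"
    by (rule torsion_of_antimono[OF subset_torsionfree_of_torsion_of[OF assms]])
qed (rule subset_torsion_of_torsionfree_of[OF torsion_of_obj])

lemma torsionfree_of_closed:
  assumes "T \<subseteq> obj C"
  shows "torsionfree_of C (torsion_of C (torsionfree_of C T)) = torsionfree_of C T"
proof (rule equalityI)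
  show "torsionfree_of C (torsion_of C (torsionfree_of C T)) \<subseteq> torsionfree_of C T"
    by (rule torsionfree_of_antimono[OF subset_torsion_of_torsionfree_of[OF assms]])
qed (rule subset_torsionfree_of_torsion_of[OF torsionfree_of_obj])

lemma torsion_of_Un: "torsion_of C (F \<union> F') = torsion_of C F \<inter> torsion_of C F'"
  unfolding torsion_of_def hom_orthogonal_def by (simp only: ball_Un ball_conj_distrib) blast

lemma torsionfree_of_Un: "torsionfree_of C (T \<union> T') = torsionfree_of C T \<inter> torsionfree_of C T'"
  unfolding torsionfree_of_def hom_orthogonal_def by (simp only: ball_Un) blast

text \<open>The full orthogonal of a class is itself orthogonal to it, so maximality forces each
  class to be the whole orthogonal of the other. In this form the Galois connection applies.\<close>

lemma torsion_theoryD: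
  assumes "torsion_theory C T F"
  shows "T = torsion_of C F" "F = torsionfree_of C T"
    "\<And>m. is_mono C m \<Longrightarrow> tgt C m \<in> T \<Longrightarrow> src C m \<in> T"
proof -
  have o: "T \<subseteq> obj C" "F \<subseteq> obj C" "hom_orthogonal C T F"
    and maxT: "\<forall>T'. T \<subseteq> T' \<longrightarrow> T' \<subseteq> obj C \<longrightarrow> hom_orthogonal C T' F \<longrightarrow> T' = T"
    and maxF: "\<forall>F'. F \<subseteq> F' \<longrightarrow> F' \<subseteq> obj C \<longrightarrow> hom_orthogonal C T F' \<longrightarrow> F' = F"
    and mono: "\<forall>m. is_mono C m \<longrightarrow> tgt C m \<in> T \<longrightarrow> src C m \<in> T"
    using assms unfolding torsion_theory_def by - (elim conjE, assumption)+
  have "T \<subseteq> torsion_of C F" using o(3) subset_torsion_of_iff[OF o(1)] by simp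
  moreover have "hom_orthogonal C (torsion_of C F) F"
    by (rule iffD1[OF subset_torsion_of_iff[OF torsion_of_obj] subset_refl])
  ultimately have "torsion_of C F = T"
    by - (rule maxT[rule_format], assumption, rule torsion_of_obj, assumption)
  then show "T = torsion_of C F" ..
  have "F \<subseteq> torsionfree_of C T" using o(3) subset_torsionfree_of_iff[OF o(2)] by simp
  moreover have "hom_orthogonal C T (torsionfree_of C T)"
    by (rule iffD1[OF subset_torsionfree_of_iff[OF torsionfree_of_obj] subset_refl])
  ultimately have "torsionfree_of C T = F"
    by - (rule maxF[rule_format], assumption, rule torsionfree_of_obj, assumption)
  then show "F = torsionfree_of C T" ..
  show "\<And>m. is_mono C m \<Longrightarrow> tgt C m \<in> T \<Longrightarrow> src C m \<in> T"
    using mono by simp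
qed

lemma torsion_theoryI:
  assumes T: "T = torsion_of C F" and F: "F = torsionfree_of C T"
    and mono: "\<And>m. is_mono C m \<Longrightarrow> tgt C m \<in> T \<Longrightarrow> src C m \<in> T"
  shows "torsion_theory C T F"
proof -
  have o: "T \<subseteq> obj C" "F \<subseteq> obj C"
    by (subst T, rule torsion_of_obj) (subst F, rule torsionfree_of_obj)
  moreover have "hom_orthogonal C T F"
    using subset_torsion_of_iff[OF o(1)] equalityD1[OF T] by simp
  moreover have "T' \<subseteq> T" if "T' \<subseteq> obj C" "hom_orthogonal C T' F" for T'
    by (subst T) (simp add: that subset_torsion_of_iff)
  moreover have "F' \<subseteq> F" if "F' \<subseteq> obj C" "hom_orthogonal C T F'" for F'
    by (subst F) (simp add: that subset_torsionfree_of_iff)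
  ultimately show ?thesis
    unfolding torsion_theory_def by (intro conjI allI impI equalityI) (assumption | rule mono | blast)+
qed

section \<open>Closure properties of torsion and torsionfree classes\<close>

context abelian_category
begin

lemma torsion_of_quotient:
  assumes "e \<in> Hom C A B" "is_epi C e" "A \<in> torsion_of C F" "F \<subseteq> obj C"
  shows "B \<in> torsion_of C F"
proof (rule torsion_ofI)
  show "B \<in> obj C" using Hom_obj[OF assms(1)] by simp
  fix Y f assume Y: "Y \<in> F" and f: "f \<in> Hom C B Y"
  show "f = zero_arr C B Y"
    using epi_zero_cancel[OF assms(2,1) f] torsion_ofD[OF assms(3) Y cmp_in_Hom[OF assms(1) f]]
    by simp
qed

lemma torsionfree_of_subobject:
  assumes "m \<in> Hom C A B" "is_mono C m" "B \<in> torsionfree_of C T"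
  shows "A \<in> torsionfree_of C T"
proof (rule torsionfree_ofI)
  show "A \<in> obj C" using Hom_obj[OF assms(1)] by simp
  fix X f assume X: "X \<in> T" and f: "f \<in> Hom C X A"
  show "f = zero_arr C X A"
    using mono_zero_cancel[OF assms(2,1) f] torsionfree_ofD[OF assms(3) X cmp_in_Hom[OF f assms(1)]]
    by simp
qed

lemma torsion_of_extension:
  assumes m: "m \<in> Hom C A B" and q: "is_cokernel C q m"
    and A: "A \<in> torsion_of C F" and Q: "tgt C q \<in> torsion_of C F"
  shows "B \<in> torsion_of C F"
proof (rule torsion_ofI)
  note qD = cokernelD[OF q m]
  show "B \<in> obj C" using Hom_obj[OF m] by simp
  fix Y f assume Y: "Y \<in> F" and f: "f \<in> Hom C B Y"
  obtain u where u: "u \<in> Hom C (tgt C q) Y" "u \<diamondop> q = f"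
    using cokernel_lift[OF q m f torsion_ofD[OF A Y cmp_in_Hom[OF m f]]] .
  show "f = zero_arr C B Y"
    using torsion_ofD[OF Q Y u(1)] u(2) cmp_zero_left[OF qD(1)] Hom_obj[OF f] by simp
qed

lemma zero_object_if_torsion_torsionfree:
  assumes "A \<in> torsion_of C F" "A \<in> F"
  shows "A \<in> zero_objects C"
proof -
  have "A \<in> obj C" using subsetD[OF torsion_of_obj assms(1)] .
  then show ?thesis using torsion_ofD[OF assms ident_in_Hom] by (simp add: zero_object_iff)
qed

text \<open>The subobject is the image of a nonzero arrow from a torsion object: it is torsion as a
  quotient of that object, and nonzero because the arrow is.\<close>

lemma torsion_subobject_of_not_torsionfree:
  assumes TF: "torsion_theory C T F" and A: "A \<in> obj C" "A \<notin> F"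
  obtains I m where "m \<in> Hom C I A" "is_mono C m" "I \<in> T" "I \<notin> zero_objects C"
proof -
  obtain X f where f: "X \<in> T" "f \<in> Hom C X A" "f \<noteq> zero_arr C X A"
    using A torsionfree_ofI[of A C T] torsion_theoryD(2)[OF TF] by blast
  obtain I e m where I: "e \<in> Hom C X I" "is_epi C e" "m \<in> Hom C I A" "is_mono C m" "m \<diamondop> e = f"
    by (rule image_factorization[OF f(2)])
  have F: "F \<subseteq> obj C" using TF by (auto simp: torsion_theory_def)
  have "I \<in> T" using torsion_of_quotient[OF I(1,2) _ F] f(1) torsion_theoryD(1)[OF TF] by simp
  moreover have "I \<notin> zero_objects C"
    using mono_zero_source[OF I(4,3)] cmp_zero_left[OF I(1) Hom_obj(2)[OF I(3)]] f(3) I(5) by auto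
  ultimately show thesis using that I by blast
qed

section \<open>Irreducibility on both sides of the correspondence\<close>

lemma zero_object_in_torsionfree_of:
  assumes "A \<in> zero_objects C"
  shows "A \<in> torsionfree_of C T"
proof (rule torsionfree_ofI)
  show "A \<in> obj C" using assms by (simp add: zero_object_iff)
  fix X f assume "f \<in> Hom C X A"
  then show "f = zero_arr C X A"
    using cmp_ident_left[of f X A] cmp_zero_left[of f X A A] assms Hom_obj[of f X A]
    by (simp add: zero_object_iff)
qed

text \<open>Matches the nontriviality clauses in the two notions of irreducibility. If
  \<open>T\<close> contains all objects, those of \<open>F\<close> are orthogonal to themselves and
  therefore have a zero identity.\<close>

lemma torsion_class_proper_iff:
  assumes TF: "torsion_theory C T F"
  shows "F \<noteq> zero_objects C \<longleftrightarrow> T \<noteq> obj C"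
proof -
  have "T = obj C" if "F = zero_objects C"
  proof -
    \<comment> \<open>A zero object is torsionfree for every class; taking \<open>UNIV\<close> as
      the class covers all sources \<open>X\<close>.\<close>
    have "f = zero_arr C X Y" if "Y \<in> zero_objects C" "f \<in> Hom C X Y" for X Y f
      using torsionfree_ofD[OF zero_object_in_torsionfree_of[OF that(1), of UNIV] UNIV_I that(2)] .
    then have "obj C \<subseteq> torsion_of C F" using that torsion_ofI[of _ C F] by blast
    then show ?thesis using torsion_theoryD(1)[OF TF] torsion_of_obj[of C F] by simp
  qed
  moreover have "F = zero_objects C" if T: "T = obj C"
  proof
    show "F \<subseteq> zero_objects C"
    proof
      fix A assume A: "A \<in> F"
      then have "A \<in> torsion_of C F"
        using torsion_theoryD(1)[OF TF] T TF unfolding torsion_theory_def by blast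
      then show "A \<in> zero_objects C" using A by (rule zero_object_if_torsion_torsionfree)
    qed
    show "zero_objects C \<subseteq> F"
      using zero_object_in_torsionfree_of[of _ T] torsion_theoryD(2)[OF TF] by blast
  qed
  ultimately show ?thesis by blast
qed

lemma sum_irreducible_iff_inter_irreducible:
  assumes TF: "torsion_theory C T F"
  shows "sum_irreducible C F \<longleftrightarrow> inter_irreducible C T"
proof
  assume irr: "sum_irreducible C F"
  have "T = T1 \<or> T = T2" if "torsion_class C T1" "torsion_class C T2" and T: "T = T1 \<inter> T2" for T1 T2
  proof -
    obtain F1 F2 where F12: "torsion_theory C T1 F1" "torsion_theory C T2 F2"
      using \<open>torsion_class C T1\<close> \<open>torsion_class C T2\<close> by (auto simp: torsion_class_def)
    have "F = torsionfree_sum C F1 F2"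
      using torsion_theoryD(1)[OF F12(1)] torsion_theoryD(1)[OF F12(2)] torsion_theoryD(2)[OF TF] T
      by (simp add: torsionfree_sum_def)
    then have "F = F1 \<or> F = F2"
      using irr F12 unfolding sum_irreducible_def torsionfree_class_def by blast
    then show ?thesis
      using torsion_theoryD(1)[OF F12(1)] torsion_theoryD(1)[OF F12(2)] torsion_theoryD(1)[OF TF]
      by auto
  qed
  then show "inter_irreducible C T"
    using TF irr torsion_class_proper_iff[OF TF]
    unfolding inter_irreducible_def sum_irreducible_def torsion_class_def by blast
next
  assume irr: "inter_irreducible C T"
  have "F = F1 \<or> F = F2"
    if "torsionfree_class C F1" "torsionfree_class C F2" and F: "F = torsionfree_sum C F1 F2" for F1 F2
  proof -
    obtain T1 T2 where T12: "torsion_theory C T1 F1" "torsion_theory C T2 F2"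
      using \<open>torsionfree_class C F1\<close> \<open>torsionfree_class C F2\<close> by (auto simp: torsionfree_class_def)
    then have "F1 \<union> F2 \<subseteq> obj C" by (auto simp: torsion_theory_def)
    \<comment> \<open>The intersection is the left orthogonal of \<open>F1 \<union> F2\<close>,
      hence Galois-closed; so the torsion class of the sum is the intersection itself and not merely
      its closure.\<close>
    then have "T = T1 \<inter> T2"
      using torsion_of_closed[of "F1 \<union> F2" C] torsion_theoryD(1)[OF T12(1)]
        torsion_theoryD(1)[OF T12(2)] torsion_theoryD(1)[OF TF] F
      by (simp add: torsionfree_sum_def torsion_of_Un)
    then have "T = T1 \<or> T = T2"
      using irr T12 unfolding inter_irreducible_def torsion_class_def by blast
    then show ?thesis
      using torsion_theoryD(2)[OF T12(1)] torsion_theoryD(2)[OF T12(2)] torsion_theoryD(2)[OF TF]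
      by auto
  qed
  then show "sum_irreducible C F"
    using TF irr torsion_class_proper_iff[OF TF]
    unfolding inter_irreducible_def sum_irreducible_def torsionfree_class_def by blast
qed

section \<open>Prime torsion theories are irreducible\<close>

lemma prime_imp_inter_irreducible:
  assumes prime: "prime_torsion_theory C T F"
  shows "inter_irreducible C T"
proof -
  have TF: "torsion_theory C T F" using prime by (simp add: prime_torsion_theory_def)
  obtain A where A: "torsion_critical C A" and FA: "F = torsionfree_gen C A"
    using prime by (auto simp: prime_torsion_theory_def)
  have AF: "A \<in> F" unfolding FA by (auto simp: torsionfree_gen_def)
  have Ao: "A \<in> obj C" "A \<notin> zero_objects C" using A by (auto simp: torsion_critical_def)
  note T = torsion_theoryD(1)[OF TF]
  have crit: "tgt C q \<in> T"
    if "is_mono C m" "m \<in> Hom C I A" "I \<notin> zero_objects C" "is_cokernel C q m" for m q I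
  proof -
    have "tgt C m = A \<and> src C m \<notin> zero_objects C" using HomD[OF that(2)] that(3) by simp
    then have "tgt C q \<in> torsion_of C (torsionfree_gen C A)"
      using A that(1,4) unfolding torsion_critical_def by blast
    then show ?thesis unfolding T FA .
  qed
  \<comment> \<open>\<open>F\<close> is the least torsionfree class containing \<open>A\<close>, so
    no torsion class for which \<open>A\<close> is torsionfree can properly contain
    \<open>T\<close>.\<close>
  have le: "T' = T" if "torsion_theory C T' F'" "A \<in> F'" "T \<subseteq> T'" for T' F'
  proof -
    have "F \<subseteq> F'" unfolding FA using that(1,2) by (auto simp: torsionfree_gen_def torsionfree_class_def)
    then have "torsion_of C F' \<subseteq> torsion_of C F" by (rule torsion_of_antimono)
    then show ?thesis
      unfolding T[symmetric] torsion_theoryD(1)[OF that(1), symmetric] using that(3) by (rule equalityI)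
  qed
  have "T = T1 \<or> T = T2" if "torsion_class C T1" "torsion_class C T2" and T12: "T = T1 \<inter> T2" for T1 T2
  proof (rule ccontr)
    assume ne: "\<not> (T = T1 \<or> T = T2)"
    obtain F1 F2 where F12: "torsion_theory C T1 F1" "torsion_theory C T2 F2"
      using \<open>torsion_class C T1\<close> \<open>torsion_class C T2\<close> by (auto simp: torsion_class_def)
    have "A \<notin> F1" "A \<notin> F2" using le[OF F12(1)] le[OF F12(2)] T12 ne by auto
    then obtain I1 m1 I2 m2 where
      m1: "m1 \<in> Hom C I1 A" "is_mono C m1" "I1 \<in> T1" "I1 \<notin> zero_objects C" and
      m2: "m2 \<in> Hom C I2 A" "is_mono C m2" "I2 \<in> T2" "I2 \<notin> zero_objects C"
      using torsion_subobject_of_not_torsionfree[OF F12(1) Ao(1)]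
        torsion_subobject_of_not_torsionfree[OF F12(2) Ao(1)] by metis
    obtain q where q: "is_cokernel C q m2" by (rule ex_cokernel'[OF m2(1)])
    note qD = cokernelD[OF q m2(1)]
    have qm: "q \<diamondop> m1 \<in> Hom C I1 (tgt C q)" using cmp_in_Hom[OF m1(1) qD(1)] .
    \<comment> \<open>The kernel of the arrow from \<open>I1\<close> to \<open>A / I2\<close>
      represents the intersection of the two subobjects; \<open>s\<close> below embeds it into
      \<open>I2\<close>.\<close>
    obtain k where k: "is_kernel C k (q \<diamondop> m1)" by (rule ex_kernel'[OF qm])
    note kD = kernelD[OF k qm]
    have mk: "m1 \<diamondop> k \<in> Hom C (src C k) A" "is_mono C (m1 \<diamondop> k)"
      using cmp_in_Hom[OF kD(1) m1(1)] mono_cmp[OF kD(3,1) m1(2,1)] by auto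
    have "q \<diamondop> (m1 \<diamondop> k) = zero_arr C (src C k) (tgt C q)"
      using cmp_assoc[OF kD(1) m1(1) qD(1)] kD(2) by simp
    then obtain s where s: "s \<in> Hom C (src C k) I2" "m2 \<diamondop> s = m1 \<diamondop> k"
      using kernel_lift[OF mono_kernel_of_cokernel[OF m2(2,1) q] qD(1) mk(1)] HomD[OF m2(1)] by metis
    have "is_mono C s" using mono_of_cmp[OF _ s(1) m2(1)] s(2) mk(2) by simp
    then have "src C k \<in> T"
      using torsion_theoryD(3)[OF F12(1) kD(3)] torsion_theoryD(3)[OF F12(2), of s]
        HomD[OF kD(1)] HomD[OF s(1)] m1(3) m2(3) T12 by simp
    moreover have "src C k \<in> F"
      using torsionfree_of_subobject[OF mk, of T] AF torsion_theoryD(2)[OF TF] by simp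
    ultimately have z: "src C k \<in> zero_objects C"
      using zero_object_if_torsion_torsionfree T by simp
    have "is_mono C (q \<diamondop> m1)"
    proof (rule mono_zeroI[OF qm])
      fix X g assume g: "g \<in> Hom C X I1" and "(q \<diamondop> m1) \<diamondop> g = zero_arr C X (tgt C q)"
      then obtain t where t: "t \<in> Hom C X (src C k)" "k \<diamondop> t = g" using kernel_lift[OF k qm g] by blast
      have "k = zero_arr C (src C k) I1" using mono_zero_source[OF kD(3,1)] z by simp
      then show "g = zero_arr C X I1" using t(2) cmp_zero_left[OF t(1)] Hom_obj[OF g] by metis
    qed
    then have "I1 \<in> T"
      using torsion_theoryD(3)[OF TF, of "q \<diamondop> m1"] HomD[OF qm] crit[OF m2(2,1,4) q] by simp
    moreover have "I1 \<in> F"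
      using torsionfree_of_subobject[OF m1(1,2), of T] AF torsion_theoryD(2)[OF TF] by simp
    ultimately show False using zero_object_if_torsion_torsionfree T m1(4) by simp
  qed
  moreover have "T \<noteq> obj C"
    using zero_object_if_torsion_torsionfree[of A F] AF Ao T by auto
  ultimately show ?thesis using TF unfolding inter_irreducible_def torsion_class_def by blast
qed

end

section \<open>Colimits and essential quotients\<close>

lemma coproduct_ex1:
  assumes "is_coproduct C I A X \<iota>" "Y \<in> obj C" "\<And>i. i \<in> I \<Longrightarrow> g i \<in> Hom C (A i) Y"
  shows "\<exists>!u. u \<in> Hom C X Y \<and> (\<forall>i\<in>I. u \<diamondop>\<^bsub>C\<^esub> \<iota> i = g i)"
proof -
  have "\<forall>g. (\<forall>i\<in>I. g i \<in> Hom C (A i) Y) \<longrightarrow>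
      (\<exists>!u. u \<in> Hom C X Y \<and> (\<forall>i\<in>I. u \<diamondop>\<^bsub>C\<^esub> \<iota> i = g i))"
    using assms(1,2) unfolding is_coproduct_def by blast
  then show ?thesis using assms(3) by blast
qed

lemma colimit_ex1:
  assumes "is_colimit C I r A a X c" "is_cocone C I r A a Y d"
  shows "\<exists>!u. u \<in> Hom C X Y \<and> (\<forall>i\<in>I. u \<diamondop>\<^bsub>C\<^esub> c i = d i)"
  using assms unfolding is_colimit_def by blast

section \<open>Generators, direct limits and chains of quotients\<close>

context grothendieck_category
begin

text \<open>Coproducts and exact direct limits are postulated for index sets inside
  \<open>U\<close>, whereas the natural indices below are arrows. The injection moves a set of
  parallel arrows into \<open>U\<close>, where it stays small.\<close>

lemma small_embedding:
  assumes "A \<in> obj C" "B \<in> obj C" "D \<subseteq> Hom C A B"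
  obtains \<phi> where "inj_on \<phi> D" "\<phi> ` D \<subseteq> U" "\<phi> ` D \<prec> U"
proof -
  have D: "D \<prec> U"
    using lesspoll_trans1[OF subset_imp_lepoll[OF assms(3)] Hom_small[OF assms(1,2)]] .
  then obtain \<phi> where \<phi>: "inj_on \<phi> D" "\<phi> ` D \<subseteq> U"
    using lesspoll_imp_lepoll unfolding lepoll_def by blast
  moreover have "\<phi> ` D \<prec> U"
    using lesspoll_trans1[OF eqpoll_imp_lepoll[OF inj_on_image_eqpoll_self[OF \<phi>(1)]] D] .
  ultimately show thesis using that by blast
qed

lemma generator_zero:
  assumes G: "generating C {G}" and f: "f \<in> Hom C A B"
    and z: "\<And>h. h \<in> Hom C G A \<Longrightarrow> f \<diamondop> h = zero_arr C G B"
  shows "f = zero_arr C A B"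
proof (rule ccontr)
  assume "f \<noteq> zero_arr C A B"
  then obtain h where h: "h \<in> Hom C G A" "f \<diamondop> h \<noteq> zero_arr C A B \<diamondop> h"
    using G f zero_in_Hom[OF Hom_obj[OF f]] Hom_obj[OF f] unfolding generating_def by (metis singletonD)
  then show False using z[OF h(1)] cmp_zero_left[OF h(1)] Hom_obj[OF f] by simp
qed

text \<open>The set \<open>E\<close> may be large: it is replaced by the arrows from a generator to \<open>P\<close> that factor through
  an element of \<open>E\<close>, and these form a small set. So no closure of small sets under products is needed
  to construct direct limits.\<close>

lemma joint_cokernel:
  assumes P: "P \<in> obj C" and E: "\<And>e. e \<in> E \<Longrightarrow> e \<in> Hom C (src C e) P"
  obtains q Q where "q \<in> Hom C P Q" "is_epi C q"
    "\<forall>e\<in>E. q \<diamondop> e = zero_arr C (src C e) Q"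
    "\<forall>X. \<forall>w\<in>Hom C P X. (\<forall>e\<in>E. w \<diamondop> e = zero_arr C (src C e) X)
      \<longrightarrow> (\<exists>u\<in>Hom C Q X. u \<diamondop> q = w)"
proof -
  obtain G where G: "generating C {G}" using ex_generator by blast
  have Go: "G \<in> obj C" using G by (simp add: generating_def)
  define D where "D = {e \<diamondop> t |e t. e \<in> E \<and> t \<in> Hom C G (src C e)}"
  have D: "D \<subseteq> Hom C G P" using E cmp_in_Hom unfolding D_def by blast
  obtain \<phi> where \<phi>: "inj_on \<phi> D" "\<phi> ` D \<subseteq> U" "\<phi> ` D \<prec> U" by (rule small_embedding[OF Go P D])
  \<comment> \<open>One copy of \<open>G\<close> for each arrow in \<open>D\<close>. The arrow
    \<open>w\<close> induced below has the elements of \<open>D\<close> as components, and its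
    cokernel will be the joint cokernel.\<close>
  obtain Z \<kappa> where Z: "is_coproduct C (\<phi> ` D) (\<lambda>_. G) Z \<kappa>" using ex_coproduct[OF \<phi>(2,3), of "\<lambda>_. G"] Go by blast
  have \<kappa>: "\<kappa> (\<phi> d) \<in> Hom C G Z" if "d \<in> D" for d using Z that unfolding is_coproduct_def by blast
  have *: "\<forall>i\<in>\<phi> ` D. the_inv_into D \<phi> i \<in> Hom C G P"
    using D the_inv_into_f_f[OF \<phi>(1)] by auto
  obtain w where w: "w \<in> Hom C Z P" "\<forall>i\<in>\<phi> ` D. w \<diamondop> \<kappa> i = the_inv_into D \<phi> i"
  proof -
    have "\<exists>!w. w \<in> Hom C Z P \<and> (\<forall>i\<in>\<phi> ` D. w \<diamondop> \<kappa> i = the_inv_into D \<phi> i)"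
      using coproduct_ex1[OF Z P, of "the_inv_into D \<phi>"] * by simp
    then show thesis using that by blast
  qed
  have w\<kappa>: "w \<diamondop> \<kappa> (\<phi> d) = d" if "d \<in> D" for d using w(2) that the_inv_into_f_f[OF \<phi>(1)] by auto
  obtain q where q: "is_cokernel C q w" by (rule ex_cokernel'[OF w(1)])
  note qD = cokernelD[OF q w(1)]
  \<comment> \<open>One direction tests \<open>f \<diamondop> e\<close> on arrows from the
    generator, whose composites with \<open>e\<close> are components of \<open>w\<close>; the other
    compares \<open>f \<diamondop> w\<close> with zero on each summand of \<open>Z\<close>.\<close>
  have kills: "f \<diamondop> w = zero_arr C Z X \<longleftrightarrow> (\<forall>e\<in>E. f \<diamondop> e = zero_arr C (src C e) X)"
    if f: "f \<in> Hom C P X" for f X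
  proof
    assume z: "f \<diamondop> w = zero_arr C Z X"
    show "\<forall>e\<in>E. f \<diamondop> e = zero_arr C (src C e) X"
    proof
      fix e assume e: "e \<in> E"
      show "f \<diamondop> e = zero_arr C (src C e) X"
      proof (rule generator_zero[OF G cmp_in_Hom[OF E[OF e] f]])
        fix h assume h: "h \<in> Hom C G (src C e)"
        have eh: "e \<diamondop> h \<in> D" using e h unfolding D_def by blast
        have "f \<diamondop> (e \<diamondop> h) = zero_arr C G X"
          using cmp_assoc[OF \<kappa>[OF eh] w(1) f] w\<kappa>[OF eh] z cmp_zero_left[OF \<kappa>[OF eh]] Hom_obj[OF f]
          by simp
        then show "(f \<diamondop> e) \<diamondop> h = zero_arr C G X" using cmp_assoc[OF h E[OF e] f] by simp
      qed
    qed
  next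
    assume z: "\<forall>e\<in>E. f \<diamondop> e = zero_arr C (src C e) X"
    have fw: "f \<diamondop> w \<in> Hom C Z X" using cmp_in_Hom[OF w(1) f] .
    have zero: "zero_arr C Z X \<in> Hom C Z X" using zero_in_Hom Hom_obj[OF fw] by simp
    have "(f \<diamondop> w) \<diamondop> \<kappa> (\<phi> d) = zero_arr C G X \<and> zero_arr C Z X \<diamondop> \<kappa> (\<phi> d) = zero_arr C G X"
      if d: "d \<in> D" for d
    proof
      obtain e t where e: "e \<in> E" "t \<in> Hom C G (src C e)" "d = e \<diamondop> t" using d unfolding D_def by blast
      have "f \<diamondop> d = zero_arr C G X"
        using cmp_assoc[OF e(2) E[OF e(1)] f] e(1,3) z cmp_zero_left[OF e(2)] Hom_obj[OF f] by simp
      then show "(f \<diamondop> w) \<diamondop> \<kappa> (\<phi> d) = zero_arr C G X"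
        using cmp_assoc[OF \<kappa>[OF d] w(1) f] w\<kappa>[OF d] by simp
      show "zero_arr C Z X \<diamondop> \<kappa> (\<phi> d) = zero_arr C G X"
        using cmp_zero_left[OF \<kappa>[OF d]] Hom_obj[OF f] by simp
    qed
    then have *: "\<forall>i\<in>\<phi> ` D. (f \<diamondop> w) \<diamondop> \<kappa> i = zero_arr C G X"
      "\<forall>i\<in>\<phi> ` D. zero_arr C Z X \<diamondop> \<kappa> i = zero_arr C G X" by auto
    have "\<exists>!u. u \<in> Hom C Z X \<and> (\<forall>i\<in>\<phi> ` D. u \<diamondop> \<kappa> i = zero_arr C G X)"
      by (rule coproduct_ex1[OF Z Hom_obj(2)[OF f] zero_in_Hom[OF Go Hom_obj(2)[OF f]]])
    then show "f \<diamondop> w = zero_arr C Z X" using fw zero * by (elim ex1E) metis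
  qed
  show thesis
  proof (rule that[OF qD(1,3)])
    show "\<forall>e\<in>E. q \<diamondop> e = zero_arr C (src C e) (tgt C q)"
      using kills[OF qD(1)] qD(2) by blast
    show "\<forall>X. \<forall>f\<in>Hom C P X. (\<forall>e\<in>E. f \<diamondop> e = zero_arr C (src C e) X)
      \<longrightarrow> (\<exists>u\<in>Hom C (tgt C q) X. u \<diamondop> q = f)"
      using cokernel_lift[OF q w(1)] kills by metis
  qed
qed

text \<open>The colimit is the quotient of the coproduct that identifies \<open>\<iota> i\<close>
  with \<open>\<iota> j \<diamondop> a i j\<close> for all related \<open>i\<close> and
  \<open>j\<close>.\<close>

lemma ex_colimit:
  assumes I: "I \<subseteq> U" "I \<prec> U" and A: "direct_system C I r A a"
  shows "\<exists>X c. is_colimit C I r A a X c"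
proof -
  have r: "i \<in> I \<and> j \<in> I" if "(i, j) \<in> r" for i j
    using A that unfolding direct_system_def directed_set_def preorder_on_def by blast
  have Ao: "A i \<in> obj C" if "i \<in> I" for i using A that unfolding direct_system_def by blast
  have a: "a i j \<in> Hom C (A i) (A j)" if "(i, j) \<in> r" for i j
    using A that unfolding direct_system_def by blast
  obtain P \<iota> where P: "is_coproduct C I A P \<iota>" using ex_coproduct[OF I] Ao by blast
  have Po: "P \<in> obj C" using P by (simp add: is_coproduct_def)
  have \<iota>: "\<iota> i \<in> Hom C (A i) P" if "i \<in> I" for i using P that unfolding is_coproduct_def by blast
  \<comment> \<open>Says that \<open>d\<close> behaves under postcomposition like the difference of
    \<open>\<iota> j \<diamondop> a i j\<close> and \<open>\<iota> i\<close>. The joint cokernel of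
    all such arrows imposes the required relations.\<close>
  define diff where "diff d i j \<longleftrightarrow> d \<in> Hom C (A i) P \<and>
    (\<forall>Y. \<forall>u\<in>Hom C P Y. u \<diamondop> (\<iota> j \<diamondop> a i j) = u \<diamondop> \<iota> i \<longleftrightarrow> u \<diamondop> d = zero_arr C (A i) Y)" for d i j
  have ex_diff: "\<exists>d. diff d i j" if "(i, j) \<in> r" for i j
  proof -
    have "\<iota> j \<diamondop> a i j \<in> Hom C (A i) P" "\<iota> i \<in> Hom C (A i) P"
      using cmp_in_Hom[OF a[OF that]] \<iota> r[OF that] by auto
    from ex_difference[OF this] show ?thesis unfolding diff_def by metis
  qed
  define E where "E = {d. \<exists>i j. (i, j) \<in> r \<and> diff d i j}"
  have E: "e \<in> Hom C (src C e) P" if "e \<in> E" for e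
    using that unfolding E_def diff_def Hom_def by blast
  obtain q Q where q: "q \<in> Hom C P Q" "is_epi C q"
    "\<forall>e\<in>E. q \<diamondop> e = zero_arr C (src C e) Q"
    "\<forall>X. \<forall>w\<in>Hom C P X. (\<forall>e\<in>E. w \<diamondop> e = zero_arr C (src C e) X)
      \<longrightarrow> (\<exists>u\<in>Hom C Q X. u \<diamondop> q = w)"
    by (rule joint_cokernel[OF Po E])
  have kill: "(\<forall>e\<in>E. w \<diamondop> e = zero_arr C (src C e) Y) \<longleftrightarrow>
      (\<forall>i j. (i, j) \<in> r \<longrightarrow> (w \<diamondop> \<iota> j) \<diamondop> a i j = w \<diamondop> \<iota> i)"
    if w: "w \<in> Hom C P Y" for Y w
  proof -
    have "(w \<diamondop> \<iota> j) \<diamondop> a i j = w \<diamondop> \<iota> i \<longleftrightarrow> w \<diamondop> d = zero_arr C (src C d) Y"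
      if ij: "(i, j) \<in> r" and d: "diff d i j" for d i j
    proof -
      have "d \<in> Hom C (A i) P" and "w \<diamondop> (\<iota> j \<diamondop> a i j) = w \<diamondop> \<iota> i \<longleftrightarrow> w \<diamondop> d = zero_arr C (A i) Y"
        using d w unfolding diff_def by blast+
      then show ?thesis using cmp_assoc[OF a[OF ij] \<iota> w] r[OF ij] HomD[of d "A i" P] by simp
    qed
    then show ?thesis using ex_diff unfolding E_def by blast
  qed
  have "is_colimit C I r A a Q (\<lambda>i. q \<diamondop> \<iota> i)"
    unfolding is_colimit_def
  proof (intro conjI allI impI)
    show "is_cocone C I r A a Q (\<lambda>i. q \<diamondop> \<iota> i)"
      unfolding is_cocone_def
      using Hom_obj[OF q(1)] cmp_in_Hom[OF \<iota> q(1)] kill[OF q(1)] q(3) by blast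
    fix Y d assume d: "is_cocone C I r A a Y d"
    then have dH: "\<forall>i\<in>I. d i \<in> Hom C (A i) Y" and Y: "Y \<in> obj C"
      and dr: "\<And>i j. (i, j) \<in> r \<Longrightarrow> d j \<diamondop> a i j = d i" unfolding is_cocone_def by blast+
    have univ: "\<exists>!u. u \<in> Hom C P Y \<and> (\<forall>i\<in>I. u \<diamondop> \<iota> i = d i)"
      using coproduct_ex1[OF P Y] dH by simp
    then obtain w where w: "w \<in> Hom C P Y" "\<forall>i\<in>I. w \<diamondop> \<iota> i = d i" by blast
    have "\<forall>i j. (i, j) \<in> r \<longrightarrow> (w \<diamondop> \<iota> j) \<diamondop> a i j = w \<diamondop> \<iota> i" using w(2) dr r by metis
    then obtain u where u: "u \<in> Hom C Q Y" "u \<diamondop> q = w" using q(4) w(1) kill[OF w(1)] by blast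
    have as: "v \<diamondop> (q \<diamondop> \<iota> i) = (v \<diamondop> q) \<diamondop> \<iota> i" if "i \<in> I" "v \<in> Hom C Q Y" for v i
      using cmp_assoc[OF \<iota>[OF that(1)] q(1) that(2)] .
    show "\<exists>!u. u \<in> Hom C Q Y \<and> (\<forall>i\<in>I. u \<diamondop> (q \<diamondop> \<iota> i) = d i)"
    proof (rule ex1I[of _ u])
      show "u \<in> Hom C Q Y \<and> (\<forall>i\<in>I. u \<diamondop> (q \<diamondop> \<iota> i) = d i)" using u w(2) as by simp
      fix v assume v: "v \<in> Hom C Q Y \<and> (\<forall>i\<in>I. v \<diamondop> (q \<diamondop> \<iota> i) = d i)"
      then have "v \<diamondop> q = w" using univ w as cmp_in_Hom[OF q(1)] by metis
      then show "v = u" using epi_cancel[OF q(2,1)] v u by metis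
    qed
  qed
  then show ?thesis by blast
qed

text \<open>The bound is the colimit \<open>R\<close> of the quotients \<open>Q i\<close>. The arrow
  \<open>p\<close> is epi because arrows out of \<open>R\<close> are determined by their composites
  with the epimorphisms \<open>P i\<close>. That \<open>p \<diamondop> y\<close> stays mono is
  exactness of the direct limit of the sequences formed by \<open>Y\<close>, \<open>Q i\<close> and
  the cokernel of \<open>P i \<diamondop> y\<close>.\<close>

lemma quotient_chain_bound:
  assumes I: "I \<subseteq> U" "I \<prec> U" "I \<noteq> {}" and y: "y \<in> Hom C Y X"
    and P: "\<And>i. i \<in> I \<Longrightarrow> P i \<in> Hom C X (Q i)" "\<And>i. i \<in> I \<Longrightarrow> is_epi C (P i)"
    and mono: "\<And>i. i \<in> I \<Longrightarrow> is_mono C (P i \<diamondop> y)"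
    and total: "\<And>i j. i \<in> I \<Longrightarrow> j \<in> I \<Longrightarrow>
      (\<exists>s\<in>Hom C (Q i) (Q j). s \<diamondop> P i = P j) \<or> (\<exists>s\<in>Hom C (Q j) (Q i). s \<diamondop> P j = P i)"
  obtains p R where "p \<in> Hom C X R" "is_epi C p" "is_mono C (p \<diamondop> y)"
    "\<forall>i\<in>I. \<exists>s\<in>Hom C (Q i) R. s \<diamondop> P i = p"
proof -
  define r where "r = {(i, j). i \<in> I \<and> j \<in> I \<and> (\<exists>s\<in>Hom C (Q i) (Q j). s \<diamondop> P i = P j)}"
  \<comment> \<open>Since \<open>P i\<close> is epi, such an arrow is unique; this is what makes the
    chosen transition arrows compatible with identities and composition.\<close>
  define b where "b i j = (SOME s. s \<in> Hom C (Q i) (Q j) \<and> s \<diamondop> P i = P j)" for i j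
  have b: "b i j \<in> Hom C (Q i) (Q j)" "b i j \<diamondop> P i = P j" if "(i, j) \<in> r" for i j
    using someI_ex[of "\<lambda>s. s \<in> Hom C (Q i) (Q j) \<and> s \<diamondop> P i = P j"] that
    unfolding b_def r_def by blast+
  have rI: "i \<in> I" "j \<in> I" if "(i, j) \<in> r" for i j using that by (auto simp: r_def)
  have Qo: "Q i \<in> obj C" if "i \<in> I" for i using Hom_obj[OF P(1)[OF that]] by simp
  have refl: "(i, i) \<in> r" if "i \<in> I" for i
    using that ident_in_Hom[OF Qo[OF that]] cmp_ident_left[OF P(1)[OF that]] by (auto simp: r_def)
  have bb: "(b j k \<diamondop> b i j) \<diamondop> P i = P k" "b j k \<diamondop> b i j \<in> Hom C (Q i) (Q k)"
    if "(i, j) \<in> r" "(j, k) \<in> r" for i j k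
    using cmp_assoc[OF P(1)[OF rI(1)[OF that(1)]] b(1)[OF that(1)] b(1)[OF that(2)]]
      b(2)[OF that(1)] b(2)[OF that(2)] cmp_in_Hom[OF b(1)[OF that(1)] b(1)[OF that(2)]] by auto
  have trans: "(i, k) \<in> r" if "(i, j) \<in> r" "(j, k) \<in> r" for i j k
    using bb[OF that] rI[OF that(1)] rI[OF that(2)] by (auto simp: r_def)
  have lin: "(i, j) \<in> r \<or> (j, i) \<in> r" if "i \<in> I" "j \<in> I" for i j
    using total[OF that] that by (auto simp: r_def)
  have "preorder_on I r"
    unfolding preorder_on_def refl_on_def trans_def
  proof (intro conjI allI impI ballI)
    show "r \<subseteq> I \<times> I" by (auto simp: r_def)
  qed (use refl trans in blast)+
  moreover have "\<exists>k\<in>I. (i, k) \<in> r \<and> (j, k) \<in> r" if "i \<in> I" "j \<in> I" for i j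
    using lin[OF that] refl that by blast
  ultimately have dir: "directed_set I r" using I(3) unfolding directed_set_def by blast
  have bid: "b i i = ident C (Q i)" if "i \<in> I" for i
    using epi_cancel[OF P(2)[OF that] P(1)[OF that] b(1)[OF refl[OF that]] ident_in_Hom[OF Qo[OF that]]]
      b(2)[OF refl[OF that]] cmp_ident_left[OF P(1)[OF that]] by simp
  have bcomp: "b j k \<diamondop> b i j = b i k" if "(i, j) \<in> r" "(j, k) \<in> r" for i j k
    using epi_cancel[OF P(2)[OF rI(1)[OF that(1)]] P(1)[OF rI(1)[OF that(1)]] bb(2)[OF that]
        b(1)[OF trans[OF that]]] bb(1)[OF that] b(2)[OF trans[OF that]] by simp
  have sysQ: "direct_system C I r Q b"
    using dir Qo bid b(1) bcomp unfolding direct_system_def by blast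

  define f where "f i = P i \<diamondop> y" for i
  have f: "f i \<in> Hom C Y (Q i)" "is_mono C (f i)" if "i \<in> I" for i
    using cmp_in_Hom[OF y P(1)[OF that]] mono[OF that] by (auto simp: f_def)
  have bf: "b i j \<diamondop> f i = f j" if "(i, j) \<in> r" for i j
    using cmp_assoc[OF y P(1)[OF rI(1)[OF that]] b(1)[OF that]] b(2)[OF that] by (simp add: f_def)
  \<comment> \<open>\<open>D i\<close> below is \<open>Q i\<close> modulo \<open>Y\<close>. The
    arrows \<open>f\<close> and \<open>g\<close> form a short exact sequence of direct systems whose
    first term is constant.\<close>
  define g where "g i = (SOME q. is_cokernel C q (f i))" for i
  have g: "is_cokernel C (g i) (f i)" if "i \<in> I" for i
    using someI_ex[of "\<lambda>q. is_cokernel C q (f i)"] ex_cokernel'[OF f(1)[OF that]] unfolding g_def by blast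
  define D where "D i = tgt C (g i)" for i
  have gD: "g i \<in> Hom C (Q i) (D i)" "g i \<diamondop> f i = zero_arr C Y (D i)" "is_epi C (g i)" if "i \<in> I" for i
    using cokernelD[OF g[OF that] f(1)[OF that]] by (auto simp: D_def)
  have Do: "D i \<in> obj C" if "i \<in> I" for i using Hom_obj[OF gD(1)[OF that]] by simp
  define d where "d i j = (SOME s. s \<in> Hom C (D i) (D j) \<and> s \<diamondop> g i = g j \<diamondop> b i j)" for i j
  have gb: "g j \<diamondop> b i j \<in> Hom C (Q i) (D j)" if "(i, j) \<in> r" for i j
    using cmp_in_Hom[OF b(1)[OF that] gD(1)[OF rI(2)[OF that]]] .
  have ex_d: "\<exists>s. s \<in> Hom C (D i) (D j) \<and> s \<diamondop> g i = g j \<diamondop> b i j" if ij: "(i, j) \<in> r" for i j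
  proof -
    have "(g j \<diamondop> b i j) \<diamondop> f i = zero_arr C Y (D j)"
      using cmp_assoc[OF f(1)[OF rI(1)[OF ij]] b(1)[OF ij] gD(1)[OF rI(2)[OF ij]]] bf[OF ij]
        gD(2)[OF rI(2)[OF ij]] by simp
    then show ?thesis
      using cokernel_lift[OF g[OF rI(1)[OF ij]] f(1)[OF rI(1)[OF ij]] gb[OF ij]] unfolding D_def by blast
  qed
  have d: "d i j \<in> Hom C (D i) (D j)" "d i j \<diamondop> g i = g j \<diamondop> b i j" if "(i, j) \<in> r" for i j
    using someI_ex[OF ex_d[OF that]] unfolding d_def by blast+
  have did: "d i i = ident C (D i)" if i: "i \<in> I" for i
    using epi_cancel[OF gD(3)[OF i] gD(1)[OF i] d(1)[OF refl[OF i]] ident_in_Hom[OF Do[OF i]]]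
      d(2)[OF refl[OF i]] bid[OF i] cmp_ident_left[OF gD(1)[OF i]] cmp_ident_right[OF gD(1)[OF i]] by simp
  have dcomp: "d j k \<diamondop> d i j = d i k" if ij: "(i, j) \<in> r" and jk: "(j, k) \<in> r" for i j k
  proof -
    note i = rI(1)[OF ij] and j = rI(2)[OF ij] and k = rI(2)[OF jk] and ik = trans[OF ij jk]
    have "(d j k \<diamondop> d i j) \<diamondop> g i = d i k \<diamondop> g i"
      using cmp_assoc[OF gD(1)[OF i] d(1)[OF ij] d(1)[OF jk]] d(2)[OF ij] d(2)[OF jk] d(2)[OF ik]
        cmp_assoc[OF b(1)[OF ij] gD(1)[OF j] d(1)[OF jk]]
        cmp_assoc[OF b(1)[OF ij] b(1)[OF jk] gD(1)[OF k]] bcomp[OF ij jk] by simp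
    then show ?thesis
      using epi_cancel[OF gD(3)[OF i] gD(1)[OF i] cmp_in_Hom[OF d(1)[OF ij] d(1)[OF jk]] d(1)[OF ik]] by simp
  qed
  have sysD: "direct_system C I r D d"
    using dir Do did d(1) dcomp unfolding direct_system_def by blast

  have Yo: "Y \<in> obj C" using Hom_obj[OF y] by simp
  have sysY: "direct_system C I r (\<lambda>_. Y) (\<lambda>_ _. ident C Y)"
    using dir Yo ident_in_Hom[OF Yo] cmp_ident_left[OF ident_in_Hom[OF Yo]] unfolding direct_system_def by blast
  have mapf: "system_map C I r (\<lambda>_. Y) (\<lambda>_ _. ident C Y) Q b f"
    using f(1) bf rI cmp_ident_right[OF f(1)] unfolding system_map_def by simp
  have mapg: "system_map C I r Q b D d g"
    using gD(1) d(2) unfolding system_map_def by simp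
  have exact: "short_exact C (f i) (g i)" if "i \<in> I" for i
    using mono_kernel_of_cokernel[OF f(2)[OF that] f(1)[OF that] g[OF that]] g[OF that]
    by (simp add: short_exact_def)
  obtain i0 where i0: "i0 \<in> I" using I(3) by blast
  \<comment> \<open>Any two indices are comparable, so a family that agrees along \<open>r\<close>
    is constant. This yields the colimit of the constant system and shows that \<open>p\<close> does
    not depend on \<open>i0\<close>.\<close>
  have const: "e i = e i0" if "i \<in> I" "\<And>i j. (i, j) \<in> r \<Longrightarrow> e j = e i" for i and e :: "'u \<Rightarrow> 'm"
    using lin[OF that(1) i0] that(2) by metis
  have colY: "is_colimit C I r (\<lambda>_. Y) (\<lambda>_ _. ident C Y) Y (\<lambda>_. ident C Y)"
    unfolding is_colimit_def
  proof (intro conjI allI impI)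
    show "is_cocone C I r (\<lambda>_. Y) (\<lambda>_ _. ident C Y) Y (\<lambda>_. ident C Y)"
      using Yo ident_in_Hom[OF Yo] cmp_ident_left[OF ident_in_Hom[OF Yo]] by (simp add: is_cocone_def)
    fix Z e assume e: "is_cocone C I r (\<lambda>_. Y) (\<lambda>_ _. ident C Y) Z e"
    then have eH: "e i \<in> Hom C Y Z" if "i \<in> I" for i using that by (simp add: is_cocone_def)
    have "e i = e i0" if "i \<in> I" for i
    proof (rule const[OF that])
      show "e j = e i" if "(i, j) \<in> r" for i j
        using e that cmp_ident_right[OF eH[OF rI(2)[OF that]]] unfolding is_cocone_def by metis
    qed
    then show "\<exists>!u. u \<in> Hom C Y Z \<and> (\<forall>i\<in>I. u \<diamondop> ident C Y = e i)"
      using eH[OF i0] i0 cmp_ident_right[of _ Y Z] by metis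
  qed
  obtain R c where R: "is_colimit C I r Q b R c" using ex_colimit[OF I(1,2) sysQ] by blast
  obtain Z z where Z: "is_colimit C I r D d Z z" using ex_colimit[OF I(1,2) sysD] by blast
  have Rc: "is_cocone C I r Q b R c" and Zc: "is_cocone C I r D d Z z"
    using R Z by (auto simp: is_colimit_def)
  have c: "c i \<in> Hom C (Q i) R" if "i \<in> I" for i using Rc that by (auto simp: is_cocone_def)
  have cb: "c j \<diamondop> b i j = c i" if "(i, j) \<in> r" for i j using Rc that by (auto simp: is_cocone_def)
  have z: "z i \<in> Hom C (D i) Z" if "i \<in> I" for i using Zc that by (auto simp: is_cocone_def)
  have zd: "z j \<diamondop> d i j = z i" if "(i, j) \<in> r" for i j using Zc that by (auto simp: is_cocone_def)
  define p where "p = c i0 \<diamondop> P i0"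
  have cP: "c i \<diamondop> P i = p" if "i \<in> I" for i
    unfolding p_def
  proof (rule const[OF that])
    show "c j \<diamondop> P j = c i \<diamondop> P i" if "(i, j) \<in> r" for i j
      using cmp_assoc[OF P(1)[OF rI(1)[OF that]] b(1)[OF that] c[OF rI(2)[OF that]]] b(2)[OF that] cb[OF that]
      by simp
  qed
  have p: "p \<in> Hom C X R" using cmp_in_Hom[OF P(1)[OF i0] c[OF i0]] by (simp add: p_def)
  have epi: "is_epi C p"
  proof (rule epiI[OF p])
    fix W v w assume v: "v \<in> Hom C R W" and w: "w \<in> Hom C R W" and eq: "v \<diamondop> p = w \<diamondop> p"
    have "w \<diamondop> c i = v \<diamondop> c i" if i: "i \<in> I" for i
    proof (rule epi_cancel[OF P(2)[OF i] P(1)[OF i] cmp_in_Hom[OF c[OF i] w] cmp_in_Hom[OF c[OF i] v]])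
      have "(w \<diamondop> c i) \<diamondop> P i = w \<diamondop> p"
        using cmp_assoc[OF P(1)[OF i] c[OF i] w] cP[OF i] by simp
      also have "\<dots> = (v \<diamondop> c i) \<diamondop> P i"
        using cmp_assoc[OF P(1)[OF i] c[OF i] v] cP[OF i] eq by simp
      finally show "(w \<diamondop> c i) \<diamondop> P i = (v \<diamondop> c i) \<diamondop> P i" .
    qed
    moreover have "is_cocone C I r Q b W (\<lambda>i. v \<diamondop> c i)"
      unfolding is_cocone_def
    proof (intro conjI ballI allI impI)
      show "(v \<diamondop> c j) \<diamondop> b i j = v \<diamondop> c i" if "(i, j) \<in> r" for i j
        using cmp_assoc[OF b(1)[OF that] c[OF rI(2)[OF that]] v] cb[OF that] by simp
    qed (use Hom_obj[OF v] cmp_in_Hom[OF c v] in simp_all)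
    then have "\<exists>!u. u \<in> Hom C R W \<and> (\<forall>i\<in>I. u \<diamondop> c i = v \<diamondop> c i)"
      by (rule colimit_ex1[OF R])
    ultimately show "v = w" using v w by (elim ex1E) metis
  qed
  have zg: "z i \<diamondop> g i \<in> Hom C (Q i) Z" if "i \<in> I" for i using cmp_in_Hom[OF gD(1)[OF that] z[OF that]] .
  have "(z j \<diamondop> g j) \<diamondop> b i j = z i \<diamondop> g i" if ij: "(i, j) \<in> r" for i j
    using cmp_assoc[OF b(1)[OF ij] gD(1)[OF rI(2)[OF ij]] z[OF rI(2)[OF ij]]] d(2)[OF ij] zd[OF ij]
      cmp_assoc[OF gD(1)[OF rI(1)[OF ij]] d(1)[OF ij] z[OF rI(2)[OF ij]]] by simp
  then have "is_cocone C I r Q b Z (\<lambda>i. z i \<diamondop> g i)"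
    using zg Hom_obj[OF z[OF i0]] unfolding is_cocone_def by blast
  then obtain v where v: "v \<in> Hom C R Z" "\<forall>i\<in>I. v \<diamondop> c i = z i \<diamondop> g i"
    using colimit_ex1[OF R] by blast
  have py: "p \<diamondop> y \<in> Hom C Y R" using cmp_in_Hom[OF y p] .
  have "(p \<diamondop> y) \<diamondop> ident C Y = c i \<diamondop> f i" if i: "i \<in> I" for i
    using cmp_ident_right[OF py] cmp_assoc[OF y P(1)[OF i] c[OF i]] cP[OF i] by (simp add: f_def)
  then have "short_exact C (p \<diamondop> y) v"
    using direct_limits_exact[OF I(1,2) sysY sysQ sysD mapf mapg exact colY R Z py _ v(1)] v(2) by simp
  then have "is_mono C (p \<diamondop> y)" using kernelD[OF _ v(1)] by (simp add: short_exact_def)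
  then show thesis using that[OF p epi] c cP by blast
qed

text \<open>Choose \<open>p\<close> maximal, by Zorn's lemma, among the quotients of
  \<open>X\<close> on which \<open>y\<close> remains mono. A further quotient that keeps
  \<open>Y\<close> embedded must then be an isomorphism, which is essentiality of
  \<open>p \<diamondop> y\<close>.\<close>

lemma essential_quotient:
  assumes y: "y \<in> Hom C Y X" "is_mono C y"
  obtains p Q where "p \<in> Hom C X Q" "is_epi C p" "is_mono C (p \<diamondop> y)"
    "\<forall>R. \<forall>s\<in>Hom C Q R. is_mono C (s \<diamondop> (p \<diamondop> y)) \<longrightarrow> is_mono C s"
proof -
  obtain G where G: "generating C {G}" using ex_generator by blast
  have Go: "G \<in> obj C" using G by (simp add: generating_def)
  have Xo: "X \<in> obj C" using Hom_obj[OF y(1)] by simp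
  \<comment> \<open>The quotients may form a large class, but every \<open>kill p\<close> is a
    subset of a single hom-set. As \<open>G\<close> detects the kernel of \<open>p\<close>,
    inclusion of these sets is the factorization order on good quotients.\<close>
  define kill where "kill p = {h \<in> Hom C G X. p \<diamondop> h = zero_arr C G (tgt C p)}" for p
  define good where "good p \<longleftrightarrow> p \<in> Hom C X (tgt C p) \<and> is_epi C p \<and> is_mono C (p \<diamondop> y)" for p
  have factor: "\<exists>s\<in>Hom C (tgt C p) (tgt C p'). s \<diamondop> p = p'"
    if "good p" "good p'" "kill p \<subseteq> kill p'" for p p'
  proof -
    have p: "p \<in> Hom C X (tgt C p)" "is_epi C p" and p': "p' \<in> Hom C X (tgt C p')"
      using that by (auto simp: good_def)
    obtain k where k: "is_kernel C k p" by (rule ex_kernel'[OF p(1)])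
    note kD = kernelD[OF k p(1)]
    have "p' \<diamondop> k = zero_arr C (src C k) (tgt C p')"
    proof (rule generator_zero[OF G cmp_in_Hom[OF kD(1) p']])
      fix h assume h: "h \<in> Hom C G (src C k)"
      have "p \<diamondop> (k \<diamondop> h) = zero_arr C G (tgt C p)"
        using cmp_assoc[OF h kD(1) p(1)] kD(2) cmp_zero_left[OF h] Hom_obj[OF p(1)] by simp
      then have "k \<diamondop> h \<in> kill p'" using cmp_in_Hom[OF h kD(1)] that(3) by (auto simp: kill_def)
      then show "(p' \<diamondop> k) \<diamondop> h = zero_arr C G (tgt C p')"
        using cmp_assoc[OF h kD(1) p'] by (simp add: kill_def)
    qed
    then show ?thesis using cokernel_lift[OF epi_cokernel_of_kernel[OF p(2,1) k] kD(1) p'] by metis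
  qed
  have mono: "kill p \<subseteq> kill (s \<diamondop> p)" if p: "p \<in> Hom C X Q" and s: "s \<in> Hom C Q R" for p s Q R
  proof
    fix h assume "h \<in> kill p"
    then have h: "h \<in> Hom C G X" "p \<diamondop> h = zero_arr C G Q" using HomD[OF p] by (auto simp: kill_def)
    then show "h \<in> kill (s \<diamondop> p)"
      using cmp_assoc[OF h(1) p s] cmp_zero_right[OF s Go] HomD[OF cmp_in_Hom[OF p s]]
      by (simp add: kill_def)
  qed
  have "\<exists>M\<in>kill ` Collect good. \<forall>N\<in>kill ` Collect good. M \<subseteq> N \<longrightarrow> N = M"
  proof (rule subset_Zorn)
    fix \<C> assume chain: "subset.chain (kill ` Collect good) \<C>"
    have sub: "\<C> \<subseteq> kill ` Collect good" and comp: "\<And>M N. M \<in> \<C> \<Longrightarrow> N \<in> \<C> \<Longrightarrow> M \<subseteq> N \<or> N \<subseteq> M"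
      using chain unfolding subset.chain_def by auto
    show "\<exists>N\<in>kill ` Collect good. \<forall>M\<in>\<C>. M \<subseteq> N"
    proof (cases "\<C> = {}")
      case True
      have "good (ident C X)"
        using ident_in_Hom[OF Xo] ident_epi[OF Xo] cmp_ident_left[OF y(1)] y(2) HomD[OF ident_in_Hom[OF Xo]]
        by (simp add: good_def)
      then show ?thesis using True by blast
    next
      case False
      \<comment> \<open>The zero arrow lies in every \<open>kill p\<close>, so the index set of the
        direct system is not empty.\<close>
      have ne: "\<Union>\<C> \<noteq> {}"
      proof -
        obtain p where "good p" "kill p \<in> \<C>" using False sub by blast
        then have "zero_arr C G X \<in> kill p"
          using zero_in_Hom[OF Go Xo] cmp_zero_right[of p X "tgt C p" G] Go
          by (simp add: kill_def good_def)
        then show ?thesis using \<open>kill p \<in> \<C>\<close> by blast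
      qed
      have "\<Union>\<C> \<subseteq> Hom C G X" using sub by (auto simp: kill_def)
      then obtain \<phi> where \<phi>: "inj_on \<phi> (\<Union>\<C>)" "\<phi> ` \<Union>\<C> \<subseteq> U" "\<phi> ` \<Union>\<C> \<prec> U"
        by (rule small_embedding[OF Go Xo])
      \<comment> \<open>The index set consists of the arrows in the union of the chain: each selects
        a quotient of the chain that kills it. This keeps the indices small, and the selected
        quotients together still kill the whole union.\<close>
      have "\<forall>i\<in>\<phi> ` \<Union>\<C>. \<exists>p. good p \<and> kill p \<in> \<C> \<and> (\<exists>h\<in>kill p. \<phi> h = i)" using sub by blast
      then obtain P where P: "\<And>i. i \<in> \<phi> ` \<Union>\<C> \<Longrightarrow> good (P i) \<and> kill (P i) \<in> \<C> \<and> (\<exists>h\<in>kill (P i). \<phi> h = i)"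
        by metis
      obtain p R where p: "p \<in> Hom C X R" "is_epi C p" "is_mono C (p \<diamondop> y)"
        "\<forall>i\<in>\<phi> ` \<Union>\<C>. \<exists>s\<in>Hom C (tgt C (P i)) R. s \<diamondop> P i = p"
      proof (rule quotient_chain_bound[OF \<phi>(2,3) _ y(1), of P "\<lambda>i. tgt C (P i)"])
        show "\<phi> ` \<Union>\<C> \<noteq> {}" using ne by blast
        show "(\<exists>s\<in>Hom C (tgt C (P i)) (tgt C (P j)). s \<diamondop> P i = P j) \<or>
          (\<exists>s\<in>Hom C (tgt C (P j)) (tgt C (P i)). s \<diamondop> P j = P i)"
          if "i \<in> \<phi> ` \<Union>\<C>" "j \<in> \<phi> ` \<Union>\<C>" for i j
          using P[OF that(1)] P[OF that(2)] factor[of "P i" "P j"] factor[of "P j" "P i"]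
            comp[of "kill (P i)" "kill (P j)"] by blast
      qed (use P in \<open>auto simp: good_def\<close>)
      have "M \<subseteq> kill p" if "M \<in> \<C>" for M
      proof
        fix h assume h: "h \<in> M"
        then have hU: "h \<in> \<Union>\<C>" using that by blast
        then have i: "\<phi> h \<in> \<phi> ` \<Union>\<C>" by blast
        obtain h' where h': "h' \<in> kill (P (\<phi> h))" "\<phi> h' = \<phi> h" using P[OF i] by blast
        have "h' = h" using inj_onD[OF \<phi>(1) h'(2)] h'(1) P[OF i] hU by blast
        moreover obtain s where "s \<in> Hom C (tgt C (P (\<phi> h))) R" "s \<diamondop> P (\<phi> h) = p" using p(4) i by blast
        ultimately show "h \<in> kill p" using mono[of "P (\<phi> h)" "tgt C (P (\<phi> h))" s R] h'(1) P[OF i]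
          by (auto simp: good_def)
      qed
      moreover have "good p" using p HomD[OF p(1)] by (simp add: good_def)
      ultimately show ?thesis by blast
    qed
  qed
  then obtain p where "good p" and max: "\<And>p'. good p' \<Longrightarrow> kill p \<subseteq> kill p' \<Longrightarrow> kill p' = kill p"
    by blast
  then have p: "p \<in> Hom C X (tgt C p)" "is_epi C p" "is_mono C (p \<diamondop> y)" by (auto simp: good_def)
  have py: "p \<diamondop> y \<in> Hom C Y (tgt C p)" using cmp_in_Hom[OF y(1) p(1)] .
  have "is_mono C s" if s: "s \<in> Hom C (tgt C p) R" and ms: "is_mono C (s \<diamondop> (p \<diamondop> y))" for R s
  proof -
    \<comment> \<open>The coimage part \<open>e\<close> of \<open>s\<close> makes
      \<open>e \<diamondop> p\<close> another good quotient, killing at least as much as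
      \<open>p\<close>. By maximality \<open>p\<close> factors back through it, so \<open>e\<close>
      is split mono.\<close>
    obtain J e m where e: "e \<in> Hom C (tgt C p) J" "is_epi C e"
      and m: "m \<in> Hom C J R" "is_mono C m" and me: "m \<diamondop> e = s"
      by (rule image_factorization[OF s])
    have ep: "e \<diamondop> p \<in> Hom C X J" using cmp_in_Hom[OF p(1) e(1)] .
    have "is_mono C (m \<diamondop> (e \<diamondop> (p \<diamondop> y)))" using ms me cmp_assoc[OF py e(1) m(1)] by simp
    then have "is_mono C (e \<diamondop> (p \<diamondop> y))" by (rule mono_of_cmp[OF _ cmp_in_Hom[OF py e(1)] m(1)])
    then have "good (e \<diamondop> p)"
      using ep epi_cmp[OF p(2,1) e(2,1)] cmp_assoc[OF y(1) p(1) e(1)] HomD[OF ep] by (simp add: good_def)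
    then obtain t where t: "t \<in> Hom C J (tgt C p)" "t \<diamondop> (e \<diamondop> p) = p"
      using factor[of "e \<diamondop> p" p] max[of "e \<diamondop> p"] mono[OF p(1) e(1)] \<open>good p\<close> HomD[OF ep] by auto
    have "(t \<diamondop> e) \<diamondop> p = ident C (tgt C p) \<diamondop> p"
      using cmp_assoc[OF p(1) e(1) t(1)] t(2) cmp_ident_left[OF p(1)] by simp
    then have "t \<diamondop> e = ident C (tgt C p)"
      using epi_cancel[OF p(2,1) cmp_in_Hom[OF e(1) t(1)] ident_in_Hom] Hom_obj[OF p(1)] by simp
    then have "is_mono C e" by (rule section_mono[OF e(1) t(1)])
    then show ?thesis using mono_cmp[OF _ e(1) m(2,1)] me by simp
  qed
  then show thesis using that[OF p] by blast
qed

section \<open>Generated torsion theories and critical objects\<close>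

text \<open>This avoids injective envelopes: the image of a nonzero map from a subobject of \<open>X\<close> to a
  torsionfree object embeds as an essential subobject into a quotient of \<open>X\<close>, and that quotient is then
  torsionfree itself.\<close>

lemma hereditary_torsion_theory_of:
  assumes S: "S \<subseteq> obj C" and sub: "\<And>m A B. m \<in> Hom C A B \<Longrightarrow> is_mono C m \<Longrightarrow> B \<in> S \<Longrightarrow> A \<in> S"
  shows "torsion_theory C (torsion_of C (torsionfree_of C S)) (torsionfree_of C S)"
proof (rule torsion_theoryI[OF HOL.refl])
  let ?F = "torsionfree_of C S"
  show "?F = torsionfree_of C (torsion_of C ?F)" using torsionfree_of_closed[OF S] by simp
  fix i assume mono: "is_mono C i" and tgt: "tgt C i \<in> torsion_of C ?F"
  define X where "X = tgt C i"
  define Y where "Y = src C i"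
  have i: "i \<in> Hom C Y X" using mono by (simp add: X_def Y_def is_mono_def Hom_def)
  have X: "X \<in> torsion_of C ?F" using tgt by (simp add: X_def)
  have "Y \<in> torsion_of C ?F"
  proof (rule torsion_ofI)
    show "Y \<in> obj C" using Hom_obj[OF i] by simp
    fix Z f assume Z: "Z \<in> ?F" and f: "f \<in> Hom C Y Z"
    obtain k where k: "is_kernel C k f" by (rule ex_kernel'[OF f])
    note kD = kernelD[OF k f]
    obtain e where e: "is_cokernel C e k" by (rule ex_cokernel'[OF kD(1)])
    note eD = cokernelD[OF e kD(1)]
    define I where "I = tgt C e"
    have eI: "e \<in> Hom C Y I" using eD(1) by (simp add: I_def)
    obtain m where m: "m \<in> Hom C I Z" "is_mono C m" "m \<diamondop> e = f"
      using coimage_factorization[OF f k e] unfolding I_def by blast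
    have I: "I \<in> ?F" using torsionfree_of_subobject[OF m(1,2) Z] .
    have ik: "i \<diamondop> k \<in> Hom C (src C k) X" using cmp_in_Hom[OF kD(1) i] .
    \<comment> \<open>\<open>\<pi>\<close> divides \<open>X\<close> by the kernel of
      \<open>f\<close>. Then \<open>\<pi> \<diamondop> i\<close> has the same kernel as
      \<open>f\<close>, so the image \<open>I\<close> of \<open>f\<close> embeds into this quotient
      of \<open>X\<close> by \<open>y\<close>.\<close>
    obtain \<pi> where \<pi>: "is_cokernel C \<pi> (i \<diamondop> k)" by (rule ex_cokernel'[OF ik])
    note \<pi>D = cokernelD[OF \<pi> ik]
    have \<pi>i: "\<pi> \<diamondop> i \<in> Hom C Y (tgt C \<pi>)" using cmp_in_Hom[OF i \<pi>D(1)] .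
    have \<pi>ik: "(\<pi> \<diamondop> i) \<diamondop> k = zero_arr C (src C k) (tgt C \<pi>)"
      using cmp_assoc[OF kD(1) i \<pi>D(1)] \<pi>D(2) by simp
    have ker: "is_kernel C k (\<pi> \<diamondop> i)"
    proof (rule kernelI[OF kD(1,3) \<pi>i \<pi>ik])
      fix W w assume w: "w \<in> Hom C W Y" and "(\<pi> \<diamondop> i) \<diamondop> w = zero_arr C W (tgt C \<pi>)"
      then have "\<pi> \<diamondop> (i \<diamondop> w) = zero_arr C W (tgt C \<pi>)" using cmp_assoc[OF w i \<pi>D(1)] by simp
      then obtain t where t: "t \<in> Hom C W (src C k)" "(i \<diamondop> k) \<diamondop> t = i \<diamondop> w"
        using kernel_lift[OF mono_kernel_of_cokernel[OF mono_cmp[OF kD(3,1) mono i] ik \<pi>] \<pi>D(1)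
            cmp_in_Hom[OF w i]] HomD[OF ik] by metis
      have "k \<diamondop> t = w"
        using mono_cancel[OF mono i cmp_in_Hom[OF t(1) kD(1)] w] cmp_assoc[OF t(1) kD(1) i] t(2) by simp
      then show "\<exists>u\<in>Hom C W (src C k). k \<diamondop> u = w" using t(1) by blast
    qed
    obtain y where y: "y \<in> Hom C I (tgt C \<pi>)" "is_mono C y" "y \<diamondop> e = \<pi> \<diamondop> i"
      using coimage_factorization[OF \<pi>i ker e] unfolding I_def by blast
    obtain p Q where p: "p \<in> Hom C (tgt C \<pi>) Q" "is_epi C p" "is_mono C (p \<diamondop> y)"
      "\<forall>R. \<forall>s\<in>Hom C Q R. is_mono C (s \<diamondop> (p \<diamondop> y)) \<longrightarrow> is_mono C s"
      by (rule essential_quotient[OF y(1,2)])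
    have py: "p \<diamondop> y \<in> Hom C I Q" using cmp_in_Hom[OF y(1) p(1)] .
    \<comment> \<open>For \<open>g\<close> from an object of \<open>S\<close>, the preimage
      \<open>n\<close> of \<open>I\<close> is in \<open>S\<close>, so \<open>g\<close> vanishes on
      it because \<open>I\<close> is torsionfree. Hence the image of \<open>g\<close> meets
      \<open>I\<close> trivially, and dividing \<open>Q\<close> by it keeps \<open>I\<close>
      embedded. By essentiality the division is mono, so the image is zero.\<close>
    have Q: "Q \<in> ?F"
    proof (rule torsionfree_ofI)
      show "Q \<in> obj C" using Hom_obj[OF p(1)] by simp
      fix G g assume G: "G \<in> S" and g: "g \<in> Hom C G Q"
      obtain q where q: "is_cokernel C q (p \<diamondop> y)" by (rule ex_cokernel'[OF py])
      note qD = cokernelD[OF q py]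
      have qker: "is_kernel C (p \<diamondop> y) q" by (rule mono_kernel_of_cokernel[OF p(3) py q])
      have qg: "q \<diamondop> g \<in> Hom C G (tgt C q)" using cmp_in_Hom[OF g qD(1)] .
      obtain n where n: "is_kernel C n (q \<diamondop> g)" by (rule ex_kernel'[OF qg])
      note nD = kernelD[OF n qg]
      have gn: "g \<diamondop> n \<in> Hom C (src C n) Q" using cmp_in_Hom[OF nD(1) g] .
      have gn0: "g \<diamondop> n = zero_arr C (src C n) Q"
      proof -
        have "q \<diamondop> (g \<diamondop> n) = zero_arr C (src C n) (tgt C q)"
          using cmp_assoc[OF nD(1) g qD(1)] nD(2) by simp
        then obtain t where t: "t \<in> Hom C (src C n) I" "(p \<diamondop> y) \<diamondop> t = g \<diamondop> n"
          using kernel_lift[OF qker qD(1) gn] HomD[OF py] by metis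
        have "t = zero_arr C (src C n) I"
          using torsionfree_ofD[OF I sub[OF nD(1,3) G] t(1)] .
        then show ?thesis using t(2) cmp_zero_right[OF py] Hom_obj[OF nD(1)] by simp
      qed
      have ker_g: "is_kernel C n g"
      proof (rule kernelI[OF nD(1,3) g gn0])
        fix W w assume w: "w \<in> Hom C W G" and z: "g \<diamondop> w = zero_arr C W Q"
        have "(q \<diamondop> g) \<diamondop> w = zero_arr C W (tgt C q)"
          using cmp_assoc[OF w g qD(1)] z cmp_zero_right[OF qD(1)] Hom_obj[OF w] by simp
        then show "\<exists>u\<in>Hom C W (src C n). n \<diamondop> u = w" using kernel_lift[OF n qg w] by blast
      qed
      obtain c where c: "is_cokernel C c n" by (rule ex_cokernel'[OF nD(1)])
      note cD = cokernelD[OF c nD(1)]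
      obtain l where l: "l \<in> Hom C (tgt C c) Q" "is_mono C l" "l \<diamondop> c = g"
        by (rule coimage_factorization[OF g ker_g c])
      have ql: "q \<diamondop> l \<in> Hom C (tgt C c) (tgt C q)" using cmp_in_Hom[OF l(1) qD(1)] .
      have ql_mono: "is_mono C (q \<diamondop> l)"
        using coimage_mono[OF n c qg ql] cmp_assoc[OF cD(1) l(1) qD(1)] l(3) by simp
      obtain s where s: "is_cokernel C s l" by (rule ex_cokernel'[OF l(1)])
      note sD = cokernelD[OF s l(1)]
      have "is_mono C (s \<diamondop> (p \<diamondop> y))"
      proof (rule mono_zeroI[OF cmp_in_Hom[OF py sD(1)]])
        fix W w assume w: "w \<in> Hom C W I" and "(s \<diamondop> (p \<diamondop> y)) \<diamondop> w = zero_arr C W (tgt C s)"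
        then have "s \<diamondop> ((p \<diamondop> y) \<diamondop> w) = zero_arr C W (tgt C s)" using cmp_assoc[OF w py sD(1)] by simp
        then obtain t where t: "t \<in> Hom C W (tgt C c)" "l \<diamondop> t = (p \<diamondop> y) \<diamondop> w"
          using kernel_lift[OF mono_kernel_of_cokernel[OF l(2,1) s] sD(1) cmp_in_Hom[OF w py]]
            HomD[OF l(1)] by metis
        have "(q \<diamondop> l) \<diamondop> t = zero_arr C W (tgt C q)"
          using cmp_assoc[OF t(1) l(1) qD(1)] t(2) cmp_assoc[OF w py qD(1)] qD(2)
            cmp_zero_left[OF w] Hom_obj[OF qD(1)] by simp
        then have "t = zero_arr C W (tgt C c)" by (rule mono_zero_cancel[OF ql_mono ql t(1)])
        then have "(p \<diamondop> y) \<diamondop> w = zero_arr C W Q"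
          using t(2) cmp_zero_right[OF l(1)] Hom_obj[OF w] by simp
        then show "w = zero_arr C W I" by (rule mono_zero_cancel[OF p(3) py w])
      qed
      then have "is_mono C s" using p(4) sD(1) by blast
      then have "l = zero_arr C (tgt C c) Q" by (rule mono_zero_cancel[OF _ sD(1) l(1) sD(2)])
      then show "g = zero_arr C G Q" using l(3) cmp_zero_left[OF cD(1)] Hom_obj[OF g] by simp
    qed
    have p\<pi>: "p \<diamondop> \<pi> \<in> Hom C X Q" using cmp_in_Hom[OF \<pi>D(1) p(1)] .
    \<comment> \<open>The composite factors through an arrow from the torsion object
      \<open>X\<close> to the torsionfree object \<open>Q\<close>, so the embedded image of
      \<open>f\<close> is zero.\<close>
    have "(p \<diamondop> y) \<diamondop> e = (p \<diamondop> \<pi>) \<diamondop> i"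
      using cmp_assoc[OF eI y(1) p(1)] y(3) cmp_assoc[OF i \<pi>D(1) p(1)] by simp
    also have "\<dots> = zero_arr C Y Q"
      using torsion_ofD[OF X Q p\<pi>] cmp_zero_left[OF i] Hom_obj[OF p(1)] by simp
    finally have "e = zero_arr C Y I" by (rule mono_zero_cancel[OF p(3) py eI])
    then show "f = zero_arr C Y Z" using m(3) cmp_zero_right[OF m(1)] Hom_obj[OF f] by simp
  qed
  then show "src C i \<in> torsion_of C ?F" by (simp add: Y_def)
qed

end

section \<open>Critical objects from noetherian generators\<close>

context locally_noetherian_category
begin

text \<open>A nonzero arrow from a nontorsion object to a torsionfree one stays nonzero on some
  noetherian generator, and that generator is then not torsion.\<close>

lemma ex_noetherian_nontorsion:
  assumes TF: "torsion_theory C T F" and T: "T \<noteq> obj C"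
  obtains G where "noetherian_object C G" "G \<notin> T"
proof -
  obtain S where S: "generating C S" "\<forall>G\<in>S. noetherian_object C G"
    using ex_noetherian_generators by blast
  have TT: "T = torsion_of C F" using torsion_theoryD(1)[OF TF] .
  have "T \<subseteq> obj C" by (subst TT) (rule torsion_of_obj)
  then obtain X where X: "X \<in> obj C" "X \<notin> T" using T by blast
  have "\<exists>Y f. Y \<in> F \<and> f \<in> Hom C X Y \<and> f \<noteq> zero_arr C X Y"
  proof (rule ccontr)
    assume n: "\<not> ?thesis"
    have "X \<in> torsion_of C F"
    proof (rule torsion_ofI[OF X(1)], rule ccontr)
      fix Y f assume "Y \<in> F" "f \<in> Hom C X Y" "f \<noteq> zero_arr C X Y"
      then show False using n by blast
    qed
    then show False using X(2) TT by simp
  qed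
  then obtain Y f where f: "Y \<in> F" "f \<in> Hom C X Y" "f \<noteq> zero_arr C X Y" by blast
  obtain G h where G: "G \<in> S" and h: "h \<in> Hom C G X" "f \<diamondop> h \<noteq> zero_arr C X Y \<diamondop> h"
    using S(1) X(1) f zero_in_Hom[OF Hom_obj[OF f(2)]] Hom_obj[OF f(2)] unfolding generating_def by metis
  have "G \<notin> T"
    using torsion_ofD[of G C F Y "f \<diamondop> h"] f(1) cmp_in_Hom[OF h(1) f(2)] h(2) TT
      cmp_zero_left[OF h(1)] Hom_obj[OF f(2)] by metis
  then show thesis using that S(2) G by blast
qed

text \<open>Maximality is meant in the preorder of factorization. Were there no maximal element,
  dependent choice would produce a strictly ascending sequence of subobjects.\<close>

lemma ex_maximal_subobject:
  assumes G: "noetherian_object C G" and k0: "P k0"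
    and P: "\<And>k. P k \<Longrightarrow> is_mono C k \<and> tgt C k = G"
  obtains k where "P k" "\<And>k'. P k' \<Longrightarrow> subobject_le C k k' \<Longrightarrow> subobject_le C k' k"
proof (rule ccontr)
  note max = that
  assume "\<not> thesis"
  then have step: "\<exists>k'. P k' \<and> subobject_le C k k' \<and> \<not> subobject_le C k' k" if "P k" for k
    using max[OF that] by blast
  have "\<exists>f. \<forall>n::nat. P (f n) \<and> (subobject_le C (f n) (f (Suc n)) \<and> \<not> subobject_le C (f (Suc n)) (f n))"
    by (rule dependent_nat_choice) (use k0 step in blast)+
  then obtain f where f: "\<And>n::nat. P (f n)" "\<And>n. subobject_le C (f n) (f (Suc n))"
    "\<And>n. \<not> subobject_le C (f (Suc n)) (f n)" by blast
  then have "\<exists>N. \<forall>n\<ge>N. subobject_le C (f n) (f N)"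
    using G P unfolding noetherian_object_def by blast
  then show False using f(3) le_SucI by blast
qed

text \<open>The last clause is torsion-criticality with \<open>T\<close> in place of the torsion
  class belonging to \<open>torsionfree_gen C A\<close>; that the two agree is shown only later,
  with the help of irreducibility.\<close>

lemma ex_critical_object:
  assumes TF: "torsion_theory C T F" and T: "T \<noteq> obj C"
  obtains A where "A \<in> F" "A \<notin> zero_objects C"
    "\<forall>m q. is_mono C m \<and> tgt C m = A \<and> src C m \<notin> zero_objects C \<and> is_cokernel C q m \<longrightarrow> tgt C q \<in> T"
proof -
  have TT: "T = torsion_of C F" using torsion_theoryD(1)[OF TF] .
  obtain G where G: "noetherian_object C G" "G \<notin> T" by (rule ex_noetherian_nontorsion[OF TF T])
  have Go: "G \<in> obj C" using G(1) by (simp add: noetherian_object_def)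
  define P where "P k \<longleftrightarrow> is_mono C k \<and> tgt C k = G \<and> (\<exists>q. is_cokernel C q k \<and> tgt C q \<notin> T)" for k
  \<comment> \<open>The zero subobject, given as the kernel of the identity. Its quotient is
    \<open>G\<close> itself, which is not torsion, so \<open>P\<close> is satisfiable.\<close>
  obtain k0 where k0: "is_kernel C k0 (ident C G)" by (rule ex_kernel'[OF ident_in_Hom[OF Go]])
  have "P k0"
    using kernelD[OF k0 ident_in_Hom[OF Go]] epi_cokernel_of_kernel[OF ident_epi[OF Go] ident_in_Hom[OF Go] k0]
      G(2) HomD[OF ident_in_Hom[OF Go]] HomD unfolding P_def by metis
  then obtain k where k: "P k" "\<And>k'. P k' \<Longrightarrow> subobject_le C k k' \<Longrightarrow> subobject_le C k' k"
    using ex_maximal_subobject[OF G(1), of P] unfolding P_def by blast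
  then obtain q where q: "is_cokernel C q k" "tgt C q \<notin> T" unfolding P_def by blast
  have kH: "k \<in> Hom C (src C k) G" using k(1) by (simp add: P_def is_mono_def Hom_def)
  note qD = cokernelD[OF q(1) kH]
  define A where "A = tgt C q"
  have qA: "q \<in> Hom C G A" using qD(1) by (simp add: A_def)
  have Ao: "A \<in> obj C" using Hom_obj[OF qA] by simp
  have crit: "tgt C r \<in> T"
    if m: "is_mono C m" "m \<in> Hom C N A" "N \<notin> zero_objects C" and r: "is_cokernel C r m" for m r N
  proof (rule ccontr)
    assume nT: "tgt C r \<notin> T"
    note rD = cokernelD[OF r m(2)]
    have rq: "r \<diamondop> q \<in> Hom C G (tgt C r)" "is_epi C (r \<diamondop> q)"
      using cmp_in_Hom[OF qA rD(1)] epi_cmp[OF qD(3) qA rD(3,1)] by auto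
    \<comment> \<open>\<open>k'\<close> is the preimage in \<open>G\<close> of the subobject
      \<open>m\<close> and contains \<open>k\<close>. If the quotient by \<open>m\<close> were not
      torsion, maximality would put \<open>k'\<close> inside \<open>k\<close>, so \<open>r\<close>
      would be mono and \<open>m\<close> zero.\<close>
    obtain k' where k': "is_kernel C k' (r \<diamondop> q)" by (rule ex_kernel'[OF rq(1)])
    note k'D = kernelD[OF k' rq(1)]
    have "P k'"
      using k'D HomD[OF k'D(1)] epi_cokernel_of_kernel[OF rq(2,1) k'] HomD[OF rq(1)] nT
      unfolding P_def by auto
    moreover have "(r \<diamondop> q) \<diamondop> k = zero_arr C (src C k) (tgt C r)"
      using cmp_assoc[OF kH qA rD(1)] qD(2) cmp_zero_right[OF rD(1)] Hom_obj[OF kH] by (simp add: A_def)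
    then have "subobject_le C k k'"
      using kernel_lift[OF k' rq(1) kH] unfolding subobject_le_def by metis
    ultimately obtain u where u: "u \<in> Hom C (src C k') (src C k)" "k \<diamondop> u = k'"
      using k(2) unfolding subobject_le_def by blast
    have "q \<diamondop> k' = zero_arr C (src C k') (tgt C q)"
      using cmp_assoc[OF u(1) kH qD(1)] u(2) qD(2) cmp_zero_left[OF u(1)] Hom_obj[OF qD(1)] by simp
    then have "is_mono C r"
      using mono_of_kernel_le[OF q(1) kH _ k', of "tgt C r"] rD(1) by (simp add: A_def)
    then have "m = zero_arr C N A" by (rule mono_zero_cancel[OF _ rD(1) m(2) rD(2)])
    then show False using mono_zero_source[OF m(1,2)] m(3) by simp
  qed
  have "A \<in> F"
  proof (rule ccontr)
    assume "A \<notin> F"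
    \<comment> \<open>Both this torsion subobject and the quotient by it lie in \<open>T\<close>, so
      the extension \<open>A\<close> would too, against the choice of \<open>k\<close>.\<close>
    then obtain I m where m: "m \<in> Hom C I A" "is_mono C m" "I \<in> T" "I \<notin> zero_objects C"
      by (rule torsion_subobject_of_not_torsionfree[OF TF Ao])
    obtain r where r: "is_cokernel C r m" by (rule ex_cokernel'[OF m(1)])
    have "A \<in> T"
      using torsion_of_extension[OF m(1) r] m(3) crit[OF m(2,1,4) r] TT by simp
    then show False using q(2) by (simp add: A_def)
  qed
  moreover have "A \<notin> zero_objects C"
  proof
    assume "A \<in> zero_objects C"
    then have "A \<in> torsion_of C F"
    proof (intro torsion_ofI[OF Ao])
      fix Y f assume "A \<in> zero_objects C" "f \<in> Hom C A Y"
      then show "f = zero_arr C A Y"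
        using cmp_ident_right[of f A Y] cmp_zero_right[of f A Y A] Ao by (simp add: zero_object_iff)
    qed
    then show False using q(2) TT by (simp add: A_def)
  qed
  moreover have "\<forall>m q. is_mono C m \<and> tgt C m = A \<and> src C m \<notin> zero_objects C \<and> is_cokernel C q m \<longrightarrow> tgt C q \<in> T"
  proof (intro allI impI, elim conjE)
    fix m r assume "is_mono C m" "tgt C m = A" "src C m \<notin> zero_objects C" "is_cokernel C r m"
    then show "tgt C r \<in> T" using crit[of m "src C m" r] by (auto simp: is_mono_def Hom_def)
  qed
  ultimately show thesis by (rule that)
qed

text \<open>A nonzero kernel \<open>L\<close> of \<open>g\<close> would be a nonzero subobject of
  \<open>A\<close>. Then \<open>B / L\<close> embeds both into the torsion object
  \<open>A / L\<close> and into the torsionfree object \<open>J\<close>, so it vanishes and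
  \<open>g\<close> is zero.\<close>

lemma critical_subobject_mono:
  assumes TF: "torsion_theory C T F"
    and crit: "\<forall>m q. is_mono C m \<and> tgt C m = A \<and> src C m \<notin> zero_objects C \<and> is_cokernel C q m \<longrightarrow> tgt C q \<in> T"
    and b: "b \<in> Hom C B A" "is_mono C b" and g: "g \<in> Hom C B J" and J: "J \<in> F"
    and nz: "g \<noteq> zero_arr C B J"
  shows "is_mono C g"
proof -
  have Jo: "J \<in> obj C" using Hom_obj[OF g] by simp
  obtain l where l: "is_kernel C l g" by (rule ex_kernel'[OF g])
  note lD = kernelD[OF l g]
  have "src C l \<in> zero_objects C"
  proof (rule ccontr)
    assume nzl: "src C l \<notin> zero_objects C"
    have bl: "b \<diamondop> l \<in> Hom C (src C l) A" "is_mono C (b \<diamondop> l)"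
      using cmp_in_Hom[OF lD(1) b(1)] mono_cmp[OF lD(3,1) b(2,1)] by auto
    obtain r where r: "is_cokernel C r (b \<diamondop> l)" by (rule ex_cokernel'[OF bl(1)])
    note rD = cokernelD[OF r bl(1)]
    have "tgt C (b \<diamondop> l) = A \<and> src C (b \<diamondop> l) \<notin> zero_objects C" using HomD[OF bl(1)] nzl by simp
    then have rT: "tgt C r \<in> T" using crit bl(2) r by blast
    have rb: "r \<diamondop> b \<in> Hom C B (tgt C r)" using cmp_in_Hom[OF b(1) rD(1)] .
    have lrb: "is_kernel C l (r \<diamondop> b)"
    proof (rule kernelI[OF lD(1,3) rb])
      show "(r \<diamondop> b) \<diamondop> l = zero_arr C (src C l) (tgt C r)"
        using cmp_assoc[OF lD(1) b(1) rD(1)] rD(2) by simp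
      fix W w assume w: "w \<in> Hom C W B" and "(r \<diamondop> b) \<diamondop> w = zero_arr C W (tgt C r)"
      then have "r \<diamondop> (b \<diamondop> w) = zero_arr C W (tgt C r)" using cmp_assoc[OF w b(1) rD(1)] by simp
      then obtain t where t: "t \<in> Hom C W (src C l)" "(b \<diamondop> l) \<diamondop> t = b \<diamondop> w"
        using kernel_lift[OF mono_kernel_of_cokernel[OF bl(2,1) r] rD(1) cmp_in_Hom[OF w b(1)]]
          HomD[OF bl(1)] by metis
      have "l \<diamondop> t = w"
        using mono_cancel[OF b(2,1) cmp_in_Hom[OF t(1) lD(1)] w] cmp_assoc[OF t(1) lD(1) b(1)] t(2)
        by simp
      then show "\<exists>u\<in>Hom C W (src C l). l \<diamondop> u = w" using t(1) by blast
    qed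
    obtain c where c: "is_cokernel C c l" by (rule ex_cokernel'[OF lD(1)])
    note cD = cokernelD[OF c lD(1)]
    obtain n where n: "n \<in> Hom C (tgt C c) (tgt C r)" "is_mono C n" "n \<diamondop> c = r \<diamondop> b"
      by (rule coimage_factorization[OF rb lrb c])
    obtain n' where n': "n' \<in> Hom C (tgt C c) J" "is_mono C n'" "n' \<diamondop> c = g"
      by (rule coimage_factorization[OF g l c])
    have "tgt C c \<in> T" using torsion_theoryD(3)[OF TF n(2)] HomD[OF n(1)] rT by simp
    moreover have "J \<in> torsionfree_of C T" using J torsion_theoryD(2)[OF TF] by simp
    ultimately have "n' = zero_arr C (tgt C c) J" using torsionfree_ofD n'(1) by metis
    then show False using n'(3) cmp_zero_left[OF cD(1) Jo] nz by simp
  qed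
  then have lz: "l = zero_arr C (src C l) B" using mono_zero_source[OF lD(3,1)] by simp
  show ?thesis
  proof (rule mono_zeroI[OF g])
    fix W w assume w: "w \<in> Hom C W B" and z: "g \<diamondop> w = zero_arr C W J"
    obtain t where t: "t \<in> Hom C W (src C l)" "l \<diamondop> t = w" by (rule kernel_lift[OF l g w z])
    show "w = zero_arr C W B" using t(2) cmp_zero_left[OF t(1) Hom_obj(2)[OF w]] lz by metis
  qed
qed

section \<open>Irreducible torsion theories are prime\<close>

lemma inter_irreducible_imp_prime:
  assumes TF: "torsion_theory C T F" and irr: "inter_irreducible C T"
  shows "prime_torsion_theory C T F"
proof -
  have TT: "T = torsion_of C F" and FF: "F = torsionfree_of C T" using torsion_theoryD[OF TF] by auto
  have To: "T \<subseteq> obj C" and Fo: "F \<subseteq> obj C" using TF unfolding torsion_theory_def by blast+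
  have Tsub: "A \<in> T" if "m \<in> Hom C A B" "is_mono C m" "B \<in> T" for m A B
    using torsion_theoryD(3)[OF TF that(2)] HomD[OF that(1)] that(3) by simp
  have Fsub: "A \<in> F" if "m \<in> Hom C A B" "is_mono C m" "B \<in> F" for m A B
    using torsionfree_of_subobject[OF that(1,2)] that(3) FF by simp
  have "T \<noteq> obj C" using irr by (simp add: inter_irreducible_def)
  then obtain A where A: "A \<in> F" "A \<notin> zero_objects C"
    and crit: "\<forall>m q. is_mono C m \<and> tgt C m = A \<and> src C m \<notin> zero_objects C \<and> is_cokernel C q m \<longrightarrow> tgt C q \<in> T"
    by (rule ex_critical_object[OF TF])
  have Ao: "A \<in> obj C" using A(1) Fo by blast
  \<comment> \<open>Adding all subobjects of \<open>A\<close>, not only \<open>A\<close>, makes the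
    class closed under subobjects; so the torsion class \<open>T2\<close> it generates, the join of
    \<open>T\<close> with the one generated by \<open>A\<close>, is hereditary.\<close>
  define S where "S = T \<union> {B. \<exists>b\<in>Hom C B A. is_mono C b}"
  define T2 where "T2 = torsion_of C (torsionfree_of C S)"
  have So: "S \<subseteq> obj C" using To Hom_obj by (auto simp: S_def)
  have tt2: "torsion_theory C T2 (torsionfree_of C S)"
    unfolding T2_def
  proof (rule hereditary_torsion_theory_of[OF So])
    fix m D B assume m: "m \<in> Hom C D B" "is_mono C m" and "B \<in> S"
    then consider "B \<in> T" | b where "b \<in> Hom C B A" "is_mono C b" by (auto simp: S_def)
    then show "D \<in> S"
    proof cases
      case 1
      then show ?thesis using Tsub[OF m] by (simp add: S_def)
    next
      case 2
      then show ?thesis using cmp_in_Hom[OF m(1) 2(1)] mono_cmp[OF m(2,1) 2(2,1)] by (auto simp: S_def)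
    qed
  qed
  have ST2: "S \<subseteq> T2" unfolding T2_def by (rule subset_torsion_of_torsionfree_of[OF So])
  have "A \<in> S" using ident_in_Hom[OF Ao] ident_mono[OF Ao] by (auto simp: S_def)
  then have "A \<in> T2" using ST2 by blast
  moreover have "A \<notin> T" using zero_object_if_torsion_torsionfree[of A F] A TT by auto
  ultimately have ne: "T \<noteq> T2" by blast

  have FA: "F \<subseteq> F'" if tf: "torsionfree_class C F'" and AF': "A \<in> F'" for F'
  proof -
    obtain T' where tt': "torsion_theory C T' F'" using tf by (auto simp: torsionfree_class_def)
    note TT' = torsion_theoryD(1)[OF tt'] and FF' = torsion_theoryD(2)[OF tt']
    have T'o: "T' \<subseteq> obj C" using tt' unfolding torsion_theory_def by blast
    \<comment> \<open>The join of \<open>T\<close> and \<open>T'\<close>: a union of two classes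
      closed under subobjects is again closed, so the generated torsion theory is
      hereditary.\<close>
    define T1 where "T1 = torsion_of C (torsionfree_of C (T \<union> T'))"
    have TTo: "T \<union> T' \<subseteq> obj C" using To T'o by blast
    have tt1: "torsion_theory C T1 (torsionfree_of C (T \<union> T'))"
      unfolding T1_def
    proof (rule hereditary_torsion_theory_of[OF TTo])
      fix m D B assume m: "m \<in> Hom C D B" "is_mono C m" and B: "B \<in> T \<union> T'"
      show "D \<in> T \<union> T'"
        using B Tsub[OF m] torsion_theoryD(3)[OF tt' m(2)] HomD[OF m(1)] by auto
    qed
    have T1: "T \<union> T' \<subseteq> T1" unfolding T1_def by (rule subset_torsion_of_torsionfree_of[OF TTo])
    have "T1 \<inter> T2 \<subseteq> T"
    proof
      fix X assume X: "X \<in> T1 \<inter> T2"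
      show "X \<in> T"
        unfolding TT
      proof (rule torsion_ofI)
        show "X \<in> obj C" using X subsetD[OF torsion_of_obj] unfolding T1_def by (elim IntE)
        fix Z f assume Z: "Z \<in> F" and f: "f \<in> Hom C X Z"
        obtain J e m where e: "e \<in> Hom C X J" "is_epi C e" and m: "m \<in> Hom C J Z" "is_mono C m"
          and me: "m \<diamondop> e = f" by (rule image_factorization[OF f])
        have J: "J \<in> F" using Fsub[OF m Z] .
        have Jo: "J \<in> obj C" using Hom_obj[OF m(1)] by simp
        have J1: "J \<in> T1" and J2: "J \<in> T2"
          using torsion_of_quotient[OF e _ torsionfree_of_obj] X unfolding T1_def T2_def by blast+
        \<comment> \<open>Once this is known, \<open>J\<close> is both torsion and torsionfree for
          \<open>T2\<close>, hence zero, and with it \<open>f\<close>.\<close>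
        have "J \<in> torsionfree_of C S"
        proof (rule torsionfree_ofI[OF Jo])
          fix B g assume B: "B \<in> S" and g: "g \<in> Hom C B J"
          consider "B \<in> T" | b where "b \<in> Hom C B A" "is_mono C b" using B by (auto simp: S_def)
          then show "g = zero_arr C B J"
          proof cases
            case 1
            then show ?thesis using torsionfree_ofD[of J C T B g] J FF g by simp
          next
            case b: 2
            show ?thesis
            proof (rule ccontr)
              assume nz: "g \<noteq> zero_arr C B J"
              \<comment> \<open>Through \<open>g\<close>, \<open>B\<close> is a subobject of
                \<open>J\<close> and so lies in \<open>T1\<close>. As a subobject of
                \<open>A\<close> it is torsionfree for \<open>T\<close> and for \<open>T'\<close>,
                hence for \<open>T1\<close>; therefore it is zero.\<close>
              have gm: "is_mono C g" by (rule critical_subobject_mono[OF TF crit b g J nz])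
              have B1: "B \<in> T1" using torsion_theoryD(3)[OF tt1 gm] HomD[OF g] J1 by simp
              have "B \<in> F" using Fsub[OF b] A(1) by simp
              moreover have "B \<in> F'" using torsionfree_of_subobject[OF b, of T'] AF' FF' by simp
              ultimately have "B \<in> torsionfree_of C (T \<union> T')"
                unfolding torsionfree_of_Un FF[symmetric] FF'[symmetric] by (rule IntI)
              then have "B \<in> zero_objects C"
                using zero_object_if_torsion_torsionfree B1 unfolding T1_def by blast
              then show False
                using nz cmp_ident_right[OF g] cmp_zero_right[OF g] by (simp add: zero_object_iff)
            qed
          qed
        qed
        then have "J \<in> zero_objects C"
          using zero_object_if_torsion_torsionfree J2 unfolding T2_def by blast
        then have "m = zero_arr C J Z" using mono_zero_source[OF m(2,1)] by simp
        then show "f = zero_arr C X Z" using me cmp_zero_left[OF e(1)] Hom_obj[OF f] by simp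
      qed
    qed
    moreover have "T \<subseteq> T1 \<inter> T2" using T1 ST2 by (auto simp: S_def)
    ultimately have "T = T1 \<or> T = T2"
      using irr tt1 tt2 unfolding inter_irreducible_def torsion_class_def by blast
    \<comment> \<open>\<open>A\<close> lies in \<open>T2\<close> but not in \<open>T\<close>, which
      leaves \<open>T = T1\<close>, and \<open>T1\<close> contains \<open>T'\<close>.\<close>
    then have "T' \<subseteq> T" using ne T1 by blast
    then show ?thesis unfolding FF FF' by (rule torsionfree_of_antimono)
  qed
  have Fcl: "torsionfree_class C F" using TF by (auto simp: torsionfree_class_def)
  have F: "F = torsionfree_gen C A"
    using FA Fcl A(1) unfolding torsionfree_gen_def by blast
  have "torsion_critical C A"
    unfolding torsion_critical_def F[symmetric] TT[symmetric] using Ao A(2) crit by blast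
  then show ?thesis using TF F unfolding prime_torsion_theory_def by blast
qed

end

theorem theorem3p10:
  fixes C :: "('o, 'm, 'z) ab_cat_scheme" and U :: "'u set" and T F :: "'o set"
  assumes "locally_noetherian_category C U"
    and "torsion_theory C T F"
  shows "(prime_torsion_theory C T F \<longleftrightarrow> sum_irreducible C F) \<and>
    (sum_irreducible C F \<longleftrightarrow> inter_irreducible C T)"
proof -
  interpret locally_noetherian_category C U by (fact assms(1))
  show ?thesis
    using prime_imp_inter_irreducible inter_irreducible_imp_prime[OF assms(2)]
      sum_irreducible_iff_inter_irreducible[OF assms(2)] by blast
qed

end
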